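(* Let $k\in\mathbb N$, and let $T$ be a linear contractive operator from $\mathbf H_2(\mathbb C_+)\otimes\mathcal H(K_k)$ into itself such that $$T(\chi_tf)=\chi_tTf,\qquad T(z_jf)=z_jTf$$ for all $f\in\mathbf H_2(\mathbb C_+)\otimes\mathcal H(K_k)$, all $t\ge0$ and all $j\in\mathbb N$. Then $T$ is the operator of multiplication by a function $\mathscr H(\lambda,z)$ such that the kernel $$(1-\mathscr H(\lambda,z)\mathscr H(\nu,w)^* )\frac{K_k(z,w)}{-i(\lambda-\nu^* )}$$ is positive in $\mathbb C_+\times\mathbb K_k$.
   Context: $\mathbb N=\{1,2,\ldots\}$; $\mathbb C_+$ is the open upper half-plane; $^*$ on complex numbers is complex conjugation; a kernel is positive if it is positive semidefinite. For $t\ge0$, $\chi_t(\lambda)=e^{it\lambda}$. $\ell$ denotes the set of sequences $\alpha=(\alpha_1,\alpha_2,\ldots)$ of nonnegative integers indexed by $\mathbb N$ with $\alpha_j=0$ for all large $j$; $(2\mathbb N)^{k\alpha}=\prod_j(2j)^{k\alpha_j}$; $z^\alpha=z_1^{\alpha_1}z_2^{\alpha_2}\cdots$. Let $\mathbb K_k=\{z\in\mathbb C^{\mathbb N}:\sum_{\alpha\in\ell}|z|^{2\alpha}(2\mathbb N)^{k\alpha}<\infty\}$ and $K_k(z,w)=\sum_{\alpha\in\ell}z^\alpha(w^* )^\alpha(2\mathbb N)^{k\alpha}$ for $z,w\in\mathbb K_k$; $\mathcal H(K_k)$ is the reproducing kernel Hilbert space on $\mathbb K_k$ with kernel $K_k$.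 $\mathbf H_2(\mathbb C_+)$ is the Hardy space of $\mathbb C_+$, with reproducing kernel $\frac{1}{-i(\lambda-\nu^* )}$ (up to normalization), and $\mathbf H_2(\mathbb C_+)\otimes\mathcal H(K_k)$ is viewed as the reproducing kernel Hilbert space of functions $f(\lambda,z)$ on $\mathbb C_+\times\mathbb K_k$ with kernel $\frac{K_k(z,w)}{-i(\lambda-\nu^* )}$. Multiplication by $z_j$ is a bounded operator on $\mathcal H(K_k)$. *)

theory Defs
  imports "HOL-Analysis.Analysis"
begin

text \<open>
  A function on a set \<open>X\<close> is represented by the total function that extends it by 0 outside \<open>X\<close>.
  Under this convention the clause \<open>vanishes\<close> makes equality of elements of \<open>H\<close> the same as
  equality on \<open>X\<close>.
\<close>

definition hnorm :: "(('a \<Rightarrow> complex) \<Rightarrow> ('a \<Rightarrow> complex) \<Rightarrow> complex) \<Rightarrow> ('a \<Rightarrow> complex) \<Rightarrow> real" where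
  "hnorm ip f = sqrt (Re (ip f f))"

locale function_hilbert_space =
  fixes X :: "'a set"
    and H :: "('a \<Rightarrow> complex) set"
    and ip :: "('a \<Rightarrow> complex) \<Rightarrow> ('a \<Rightarrow> complex) \<Rightarrow> complex"
  assumes vanishes: "f \<in> H \<Longrightarrow> x \<notin> X \<Longrightarrow> f x = 0"
    and zero_mem: "(\<lambda>x. 0) \<in> H"
    and add_mem: "f \<in> H \<Longrightarrow> g \<in> H \<Longrightarrow> (\<lambda>x. f x + g x) \<in> H"
    and scale_mem: "f \<in> H \<Longrightarrow> (\<lambda>x. c * f x) \<in> H"
    and ip_add_left: "f \<in> H \<Longrightarrow> g \<in> H \<Longrightarrow> h \<in> H \<Longrightarrow> ip (\<lambda>x. f x + g x) h = ip f h + ip g h"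
    and ip_scale_left: "f \<in> H \<Longrightarrow> h \<in> H \<Longrightarrow> ip (\<lambda>x. c * f x) h = c * ip f h"
    and ip_cnj: "f \<in> H \<Longrightarrow> g \<in> H \<Longrightarrow> ip g f = cnj (ip f g)"
    and ip_nonneg: "f \<in> H \<Longrightarrow> ip f f \<in> \<real>\<^sub>\<ge>\<^sub>0"
    and ip_definite: "f \<in> H \<Longrightarrow> ip f f = 0 \<Longrightarrow> f = (\<lambda>x. 0)"
    and complete:
      "(\<And>n. s n \<in> H) \<Longrightarrow>
       (\<And>e. e > 0 \<Longrightarrow> \<exists>N. \<forall>m\<ge>N. \<forall>n\<ge>N. hnorm ip (\<lambda>x. s m x - s n x) < e) \<Longrightarrow>
       \<exists>f\<in>H. (\<lambda>n. hnorm ip (\<lambda>x. s n x - f x)) \<longlonglongrightarrow> 0"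

text \<open>
  The reproducing kernel Hilbert space with kernel \<open>K\<close> on \<open>X\<close>. By the Moore--Aronszajn theorem
  \<open>X\<close> and \<open>K\<close> determine \<open>H\<close>, and \<open>ip\<close> on \<open>H\<close>, uniquely. Inner products are linear in the first argument.
\<close>

locale reproducing_kernel_hilbert_space = function_hilbert_space +
  fixes K :: "'a \<Rightarrow> 'a \<Rightarrow> complex"
  assumes kernel_mem: "w \<in> X \<Longrightarrow> (\<lambda>x. if x \<in> X then K x w else 0) \<in> H"
    and reproducing: "f \<in> H \<Longrightarrow> w \<in> X \<Longrightarrow> ip f (\<lambda>x. if x \<in> X then K x w else 0) = f w"

definition positive_kernel_on :: "'a set \<Rightarrow> ('a \<Rightarrow> 'a \<Rightarrow> complex) \<Rightarrow> bool" where
  "positive_kernel_on X K \<longleftrightarrow>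
     (\<forall>F c. finite F \<and> F \<subseteq> X \<longrightarrow> (\<Sum>x\<in>F. \<Sum>y\<in>F. cnj (c x) * K x y * c y) \<in> \<real>\<^sub>\<ge>\<^sub>0)"

definition linear_contraction_on ::
  "('a \<Rightarrow> complex) set \<Rightarrow> (('a \<Rightarrow> complex) \<Rightarrow> ('a \<Rightarrow> complex) \<Rightarrow> complex) \<Rightarrow>
   (('a \<Rightarrow> complex) \<Rightarrow> ('a \<Rightarrow> complex)) \<Rightarrow> bool" where
  "linear_contraction_on H ip T \<longleftrightarrow>
     (\<forall>f\<in>H. T f \<in> H) \<and>
     (\<forall>f\<in>H. \<forall>g\<in>H. T (\<lambda>x. f x + g x) = (\<lambda>x. T f x + T g x)) \<and>
     (\<forall>c. \<forall>f\<in>H. T (\<lambda>x. c * f x) = (\<lambda>x. c * T f x)) \<and>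
     (\<forall>f\<in>H. hnorm ip (T f) \<le> hnorm ip f)"

text \<open>
  Sequences indexed by \<open>{1, 2, \<dots>}\<close> are represented by functions on \<^typ>\<open>nat\<close> with the index shifted
  by one: \<open>z j\<close> is the entry \<open>z\<^sub>j\<^sub>+\<^sub>1\<close>, whose weight is therefore \<open>2 (j + 1)\<close>.
\<close>

definition multi_indices :: "(nat \<Rightarrow> nat) set" where
  "multi_indices = {\<alpha>. \<forall>\<^sub>F j in sequentially. \<alpha> j = 0}"

definition mpow :: "(nat \<Rightarrow> 'a::comm_monoid_mult) \<Rightarrow> (nat \<Rightarrow> nat) \<Rightarrow> 'a" where
  "mpow z \<alpha> = (\<Prod>j | \<alpha> j \<noteq> 0. z j ^ \<alpha> j)"

definition even_weight :: "nat \<Rightarrow> (nat \<Rightarrow> nat) \<Rightarrow> real" where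
  "even_weight k \<alpha> = mpow (\<lambda>j. 2 * real (Suc j)) (\<lambda>j. k * \<alpha> j)"

definition KK_domain :: "nat \<Rightarrow> (nat \<Rightarrow> complex) set" where
  "KK_domain k =
     {z. (\<lambda>\<alpha>. mpow (\<lambda>j. cmod (z j)) (\<lambda>j. 2 * \<alpha> j) * even_weight k \<alpha>) summable_on multi_indices}"

definition K_kernel :: "nat \<Rightarrow> (nat \<Rightarrow> complex) \<Rightarrow> (nat \<Rightarrow> complex) \<Rightarrow> complex" where
  "K_kernel k z w =
     (\<Sum>\<^sub>\<infinity>\<alpha>\<in>multi_indices. mpow z \<alpha> * mpow (\<lambda>j. cnj (w j)) \<alpha> * of_real (even_weight k \<alpha>))"

definition upper_half_plane :: "complex set" where
  "upper_half_plane = {l. Im l > 0}"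

text \<open>The space \<open>\<^bold>H\<^sub>2(\<complex>\<^sub>+) \<otimes> \<H>(K\<^sub>k)\<close> is the reproducing kernel Hilbert space with this domain and kernel.\<close>

definition tensor_domain :: "nat \<Rightarrow> (complex \<times> (nat \<Rightarrow> complex)) set" where
  "tensor_domain k = upper_half_plane \<times> KK_domain k"

definition tensor_kernel ::
  "nat \<Rightarrow> complex \<times> (nat \<Rightarrow> complex) \<Rightarrow> complex \<times> (nat \<Rightarrow> complex) \<Rightarrow> complex" where
  "tensor_kernel k = (\<lambda>(l, z) (n, w). K_kernel k z w / (- \<i> * (l - cnj n)))"

definition chi :: "real \<Rightarrow> complex \<Rightarrow> complex" where
  "chi t l = exp (\<i> * of_real t * l)"

end

theory Submission
  imports Defs
begin

text \<open>
  Fix a point \<open>(\<nu>, w)\<close> and let \<open>L f = (T f)(\<nu>, w)\<close>. This functional is bounded, and the commutation relations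
  say that multiplication by \<open>\<chi>\<^sub>t\<close> and by \<open>z\<^sub>j\<close> has the same effect on it as on evaluation at \<open>(\<nu>, w)\<close>: it
  multiplies \<open>L\<close> by \<open>\<chi>\<^sub>t(\<nu>)\<close> and by \<open>w\<^sub>j\<close>. The point of the proof is that \<open>L\<close> is then a scalar multiple of
  evaluation at \<open>(\<nu>, w)\<close>; the scalar is the value \<open>h(\<nu>, w)\<close> of the multiplier. Because kernel sections span a
  dense subspace (\<open>functional_zero_of_kernel_sections\<close>), it is enough to compute \<open>L\<close> on them, and the two kinds
  of variables can be treated one after the other.

  In the variables \<open>z\<close>, the kernel is formally the product of \<open>1 / (1 - c\<^sub>j z\<^sub>j u\<^sub>j\<^sup>*)\<close>, where \<open>c\<^sub>j\<close> is the weight of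
  position \<open>j\<close>. So replacing \<open>u\<^sub>j\<close> by 0 multiplies the kernel section at \<open>u\<close> by \<open>1 - c\<^sub>j z\<^sub>j u\<^sub>j\<^sup>*\<close>. Applying \<open>L\<close>
  gives the factor \<open>1 - c\<^sub>j w\<^sub>j u\<^sub>j\<^sup>*\<close>, which is the one by which \<open>K\<^sub>k(w, u)\<close> changes. Replacing all coordinates by 0,
  with a passage to the limit, leaves the kernel sections at \<open>u = 0\<close> (\<open>L_kernel_section_factor\<close>).

  These do not depend on \<open>z\<close>, and the functions constant in \<open>z\<close> form a copy of the Hardy space. There the
  kernel section at \<open>x\<close> is \<open>\<integral> e\<^bsup>is(\<lambda> - x\<^sup>*)\<^esup> ds\<close> over \<open>[0, \<infinity>)\<close>, multiplication by \<open>\<chi>\<^sub>t\<close> followed by a scalar cuts off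
  the part over \<open>[0, t]\<close>, and hence \<open>L\<close> maps that part to \<open>(1 - e\<^bsup>it(\<nu> - x\<^sup>*)\<^esup>) L(k\<^sub>x)\<close>. For two points \<open>x\<close> and \<open>y\<close> the
  parts over \<open>[0, t]\<close> differ by \<open>O(t\<^bsup>3/2\<^esup>)\<close> in norm, so as \<open>t \<rightarrow> 0\<close> the first-order terms
  \<open>(\<nu> - x\<^sup>*) L(k\<^sub>x)\<close> and \<open>(\<nu> - y\<^sup>*) L(k\<^sub>y)\<close> coincide (\<open>eigenfunctional_on_kernel_sections\<close>). That is
  proportionality of \<open>L(k\<^sub>x)\<close> to \<open>1 / (-i(\<nu> - x\<^sup>*))\<close>.

  The Hilbert space is abstract, so membership of \<open>\<chi>\<^sub>t k\<^sub>x\<close> and of the partial integrals has to be derived from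
  the kernel alone. The tool is \<open>kernel_membership\<close>, a form of the Riesz representation theorem.
  Finally, positivity of the kernel in the conclusion expresses that the adjoint of \<open>T\<close> is a contraction
  on combinations of kernel sections (\<open>multiplier_kernel_positive\<close>).
\<close>

section \<open>Hilbert spaces of functions\<close>

context function_hilbert_space
begin

lemma diff_mem: "f \<in> H \<Longrightarrow> g \<in> H \<Longrightarrow> (\<lambda>x. f x - g x) \<in> H"
  using add_mem[of f "\<lambda>x. - 1 * g x"] scale_mem[of g "-1"] by simp

lemma sum_mem:
  "finite F \<Longrightarrow> (\<And>i. i \<in> F \<Longrightarrow> f i \<in> H) \<Longrightarrow> (\<lambda>x. \<Sum>i\<in>F. f i x) \<in> H"
  by (induction F rule: finite_induct) (auto simp: zero_mem intro: add_mem)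

lemma ip_add_right:
  assumes "f \<in> H" "g \<in> H" "h \<in> H"
  shows "ip h (\<lambda>x. f x + g x) = ip h f + ip h g"
  using ip_cnj[OF add_mem[OF assms(1,2)] assms(3)] ip_add_left[OF assms]
    ip_cnj[OF assms(1,3)] ip_cnj[OF assms(2,3)] by simp

lemma ip_scale_right:
  assumes "f \<in> H" "h \<in> H"
  shows "ip h (\<lambda>x. c * f x) = cnj c * ip h f"
  using ip_cnj[OF scale_mem[OF assms(1)] assms(2)] ip_scale_left[OF assms]
    ip_cnj[OF assms] by simp

lemma ip_diff_left:
  assumes "f \<in> H" "g \<in> H" "h \<in> H"
  shows "ip (\<lambda>x. f x - g x) h = ip f h - ip g h"
  using ip_add_left[OF assms(1) scale_mem[OF assms(2), of "-1"] assms(3)]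
    ip_scale_left[OF assms(2,3), of "-1"] by simp

lemma ip_zero_left: "h \<in> H \<Longrightarrow> ip (\<lambda>x. 0) h = 0"
  using ip_scale_left[of h h 0] by simp

lemma ip_sum_left:
  assumes "finite F" "\<And>i. i \<in> F \<Longrightarrow> f i \<in> H" "h \<in> H"
  shows "ip (\<lambda>x. \<Sum>i\<in>F. f i x) h = (\<Sum>i\<in>F. ip (f i) h)"
  using assms(1,2)
proof (induction F rule: finite_induct)
  case empty
  then show ?case by (simp add: ip_zero_left assms(3))
next
  case (insert i F)
  then show ?case
    using ip_add_left[of "f i" "\<lambda>x. \<Sum>i\<in>F. f i x" h] sum_mem[of F f] assms(3) by simp
qed

lemma hnorm_nonneg: "f \<in> H \<Longrightarrow> 0 \<le> hnorm ip f"
  using ip_nonneg[of f] by (auto simp: hnorm_def complex_nonneg_Reals_iff)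

lemma hnorm_square: "f \<in> H \<Longrightarrow> (hnorm ip f)\<^sup>2 = Re (ip f f)"
  using ip_nonneg[of f] by (auto simp: hnorm_def complex_nonneg_Reals_iff)

lemma ip_self: "f \<in> H \<Longrightarrow> ip f f = of_real ((hnorm ip f)\<^sup>2)"
  using ip_nonneg[of f]
  by (auto simp: hnorm_square complex_nonneg_Reals_iff complex_eq_iff)

lemma hnorm_scale:
  assumes "f \<in> H"
  shows "hnorm ip (\<lambda>x. c * f x) = cmod c * hnorm ip f"
proof -
  have "ip (\<lambda>x. c * f x) (\<lambda>x. c * f x) = c * cnj c * ip f f"
    by (simp add: ip_scale_left ip_scale_right scale_mem assms)
  also have "\<dots> = of_real ((cmod c * hnorm ip f)\<^sup>2)"
    by (simp add: ip_self[OF assms] complex_norm_square[symmetric] power_mult_distrib)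
  finally show ?thesis
    using hnorm_nonneg[OF assms] by (simp add: hnorm_def real_sqrt_mult)
qed

lemma hnorm_add_square:
  assumes "f \<in> H" "g \<in> H"
  shows "(hnorm ip (\<lambda>x. f x + g x))\<^sup>2 = (hnorm ip f)\<^sup>2 + 2 * Re (ip f g) + (hnorm ip g)\<^sup>2"
  using assms ip_cnj[OF assms]
  by (simp add: hnorm_square add_mem ip_add_left ip_add_right)

lemma hnorm_diff_square:
  assumes "f \<in> H" "g \<in> H"
  shows "(hnorm ip (\<lambda>x. f x - g x))\<^sup>2 = (hnorm ip f)\<^sup>2 - 2 * Re (ip f g) + (hnorm ip g)\<^sup>2"
  using hnorm_add_square[OF assms(1) scale_mem[OF assms(2), of "-1"]]
  by (simp add: ip_scale_right[OF assms(2,1), of "-1", simplified] assms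
      hnorm_scale[OF assms(2), of "-1", simplified])

lemma cauchy_schwarz:
  assumes "f \<in> H" "g \<in> H"
  shows "cmod (ip f g) \<le> hnorm ip f * hnorm ip g"
proof (cases "hnorm ip g = 0")
  case True
  then have "g = (\<lambda>x. 0)"
    using ip_definite[OF assms(2)] ip_self[OF assms(2)] by simp
  then have "ip f g = 0"
    using ip_cnj[OF assms(2,1)] ip_zero_left[OF assms(1)] by simp
  then show ?thesis using True by simp
next
  case False
  define n where "n = hnorm ip g"
  have n: "n > 0" using False hnorm_nonneg[OF assms(2)] by (simp add: n_def)
  define c where "c = ip f g / of_real (n\<^sup>2)"
  have "0 \<le> (hnorm ip (\<lambda>x. f x - c * g x))\<^sup>2" by simp
  also have "\<dots> = (hnorm ip f)\<^sup>2 - 2 * Re (cnj c * ip f g) + (cmod c * n)\<^sup>2"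
    using hnorm_diff_square[OF assms(1) scale_mem[OF assms(2), of c]]
    by (simp add: ip_scale_right hnorm_scale assms n_def)
  also have "cnj c * ip f g = of_real ((cmod (ip f g))\<^sup>2 / n\<^sup>2)"
    by (simp add: c_def complex_norm_square[symmetric] mult.commute[of "cnj _"])
  also have "(cmod c * n)\<^sup>2 = (cmod (ip f g))\<^sup>2 / n\<^sup>2"
  proof -
    have "cmod c = cmod (ip f g) / n\<^sup>2"
      using norm_of_real[of "n\<^sup>2", where 'a = complex] by (simp add: c_def norm_divide)
    then show ?thesis using n by (simp add: power2_eq_square)
  qed
  finally have "(cmod (ip f g))\<^sup>2 \<le> (hnorm ip f * n)\<^sup>2"
    using n by (simp add: field_simps power_mult_distrib)
  then show ?thesis
    using n hnorm_nonneg[OF assms(1)] unfolding n_def[symmetric]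
    by - (rule power2_le_imp_le, auto)
qed

lemma ip_limit:
  assumes s: "\<And>n. s n \<in> H" and h: "h \<in> H" and g: "g \<in> H"
    and lim: "(\<lambda>n. hnorm ip (\<lambda>x. s n x - h x)) \<longlonglongrightarrow> 0"
  shows "(\<lambda>n. ip (s n) g) \<longlonglongrightarrow> ip h g"
proof -
  have "(\<lambda>n. hnorm ip (\<lambda>x. s n x - h x) * hnorm ip g) \<longlonglongrightarrow> 0"
    using tendsto_mult_right_zero[OF lim, of "hnorm ip g"]
    by (simp add: mult.commute tendsto_mult_left_zero lim)
  moreover have "cmod (ip (s n) g - ip h g) \<le> hnorm ip (\<lambda>x. s n x - h x) * hnorm ip g" for n
    using cauchy_schwarz[OF diff_mem[OF s h] g] ip_diff_left[OF s h g] by simp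
  ultimately have "(\<lambda>n. ip (s n) g - ip h g) \<longlonglongrightarrow> 0"
    by (intro tendsto_0_le[where K = 1 and g = "\<lambda>n. ip (s n) g - ip h g"])
       (auto intro!: always_eventually order_trans[OF _ abs_ge_self])
  then show ?thesis by (simp add: LIM_zero_iff)
qed

text \<open>
  The Riesz representation theorem on a subspace. A functional on a subspace is given by its
  graph \<open>R\<close>, so that a functional prescribed on linear combinations needs no separate proof that it
  is well defined: the bound forces that. Minimizing \<open>\<parallel>s\<parallel>\<^sup>2 - 2 Re a\<close> over \<open>(s, a) \<in> R\<close> produces a minimizing
  sequence that is Cauchy by the parallelogram law, and the vanishing first variation at its limit \<open>h\<close>
  says that \<open>h\<close> represents the functional. The sequence is part of the conclusion because it puts \<open>h\<close>
  into the closure of the subspace, which is where density statements come from.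
\<close>

lemma bounded_functional_representation:
  fixes R :: "(('a \<Rightarrow> complex) \<times> complex) set"
  assumes mem: "\<And>s a. (s, a) \<in> R \<Longrightarrow> s \<in> H"
    and nonempty: "R \<noteq> {}"
    and add: "\<And>s a r b. (s, a) \<in> R \<Longrightarrow> (r, b) \<in> R \<Longrightarrow> (\<lambda>x. s x + r x, a + b) \<in> R"
    and scale: "\<And>s a c. (s, a) \<in> R \<Longrightarrow> (\<lambda>x. c * s x, c * a) \<in> R"
    and C: "0 \<le> C"
    and bound: "\<And>s a. (s, a) \<in> R \<Longrightarrow> cmod a \<le> C * hnorm ip s"
  obtains h s where "h \<in> H" "hnorm ip h \<le> C" "\<And>r a. (r, a) \<in> R \<Longrightarrow> ip r h = a"
    "\<And>n. s n \<in> fst ` R" "(\<lambda>n. hnorm ip (\<lambda>x. s n x - h x)) \<longlonglongrightarrow> 0"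
proof -
  define J where "J = (\<lambda>(s, a). (hnorm ip s)\<^sup>2 - 2 * Re a)"
  have below: "- C\<^sup>2 \<le> J p" if p: "p \<in> R" for p
  proof -
    obtain s a where sa: "p = (s, a)" by fastforce
    have "Re a \<le> C * hnorm ip s"
      using bound[of s a] complex_Re_le_cmod[of a] p sa by auto
    moreover have "0 \<le> (hnorm ip s - C)\<^sup>2" by simp
    ultimately show ?thesis by (simp add: J_def sa power2_diff) (simp add: algebra_simps)
  qed
  define m where "m = Inf (J ` R)"
  have bdd: "bdd_below (J ` R)" using below by (auto intro!: bdd_belowI)
  have m_le: "m \<le> J p" if "p \<in> R" for p
    unfolding m_def using bdd that by (intro cInf_lower) auto
  have "\<exists>p\<in>R. J p < m + inverse (real (Suc n))" for n
    using cInf_lessD[of "J ` R" "m + inverse (real (Suc n))"] nonempty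
    by (auto simp: m_def)
  then obtain p where p: "\<And>n. p n \<in> R" "\<And>n. J (p n) < m + inverse (real (Suc n))"
    by metis
  define s where "s = (\<lambda>n. fst (p n))"
  define a where "a = (\<lambda>n. snd (p n))"
  have sR: "(s n, a n) \<in> R" for n using p(1)[of n] by (simp add: s_def a_def)
  have sH: "s n \<in> H" for n using mem[OF sR] .
  have J_less: "J (s n, a n) < m + inverse (real (Suc n))" for n
    using p(2)[of n] by (simp add: s_def a_def)
  have dist: "(hnorm ip (\<lambda>x. s i x - s j x))\<^sup>2
      \<le> 2 * inverse (real (Suc i)) + 2 * inverse (real (Suc j))" for i j
  proof -
    have "(\<lambda>x. (1/2) * (s i x + s j x), (1/2) * (a i + a j)) \<in> R"
      by (rule scale[OF add[OF sR sR]])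
    (* the midpoint competes with both terms, which by the parallelogram law keeps them close *)
    from m_le[OF this]
    have "m \<le> (hnorm ip (\<lambda>x. s i x + s j x))\<^sup>2 / 4 - Re (a i) - Re (a j)"
      unfolding J_def hnorm_scale[OF add_mem[OF sH[of i] sH[of j]], of "1/2"] prod.case
      by (simp add: power_mult_distrib power2_eq_square add_divide_distrib)
    then show ?thesis
      using hnorm_add_square[OF sH[of i] sH[of j]] hnorm_diff_square[OF sH[of i] sH[of j]]
        J_less[of i] J_less[of j] unfolding J_def prod.case by linarith
  qed
  have "\<exists>h\<in>H. (\<lambda>n. hnorm ip (\<lambda>x. s n x - h x)) \<longlonglongrightarrow> 0"
  proof (rule complete[OF sH])
    fix e :: real assume e: "e > 0"
    obtain N where N: "inverse (real (Suc N)) < e\<^sup>2 / 4"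
      using reals_Archimedean[of "e\<^sup>2 / 4"] e by auto
    have "hnorm ip (\<lambda>x. s i x - s j x) < e" if "i \<ge> N" "j \<ge> N" for i j
    proof -
      have "inverse (real (Suc i)) \<le> inverse (real (Suc N))"
        "inverse (real (Suc j)) \<le> inverse (real (Suc N))"
        using that by (auto intro!: le_imp_inverse_le)
      then have "(hnorm ip (\<lambda>x. s i x - s j x))\<^sup>2 < e\<^sup>2"
        using dist[of i j] N by linarith
      then show ?thesis using e by - (rule power2_less_imp_less, auto)
    qed
    then show "\<exists>N. \<forall>m\<ge>N. \<forall>n\<ge>N. hnorm ip (\<lambda>x. s m x - s n x) < e" by blast
  qed
  then obtain h where h: "h \<in> H" and lim: "(\<lambda>n. hnorm ip (\<lambda>x. s n x - h x)) \<longlonglongrightarrow> 0"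
    by blast
  have Re_eq: "Re (ip h r) = Re b" if rb: "(r, b) \<in> R" for r b
  proof -
    have r: "r \<in> H" using mem[OF rb] .
    define d where "d = 2 * (Re (ip h r) - Re b)"
    have ineq: "0 \<le> e * d + e\<^sup>2 * (hnorm ip r)\<^sup>2" for e :: real
    proof -
      have step: "0 \<le> inverse (real (Suc n)) + (e * (2 * (Re (ip (s n) r) - Re b)) + e\<^sup>2 * (hnorm ip r)\<^sup>2)" for n
      proof -
        have "(\<lambda>x. s n x + of_real e * r x, a n + of_real e * b) \<in> R"
          by (rule add[OF sR scale[OF rb]])
        from m_le[OF this] J_less[of n] show ?thesis
          using hnorm_add_square[OF sH[of n] scale_mem[OF r, of "of_real e"]]
          by (simp add: J_def hnorm_scale[OF r] ip_scale_right[OF r sH] power_mult_distrib algebra_simps)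
      qed
      have "(\<lambda>n. inverse (real (Suc n)) + (e * (2 * (Re (ip (s n) r) - Re b)) + e\<^sup>2 * (hnorm ip r)\<^sup>2))
          \<longlonglongrightarrow> 0 + (e * (2 * (Re (ip h r) - Re b)) + e\<^sup>2 * (hnorm ip r)\<^sup>2)"
        by (intro tendsto_intros LIMSEQ_inverse_real_of_nat ip_limit sH h r lim)
      from LIMSEQ_le_const[OF this] step show ?thesis by (auto simp: d_def)
    qed
    (* a quadratic in e that is nonnegative for all e has no linear term; e = - d / q makes the
       linear term beat the quadratic one *)
    have "d = 0"
    proof (rule ccontr)
      assume "d \<noteq> 0"
      define q where "q = (hnorm ip r)\<^sup>2 + 1"
      have q: "q > 0" by (simp add: q_def add_nonneg_pos)
      have "0 \<le> (- d / q) * d + (- d / q)\<^sup>2 * (q - 1)"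
        using ineq[of "- d / q"] by (simp add: q_def)
      also have "\<dots> = - (d\<^sup>2 / q\<^sup>2)"
        using q by (simp add: field_simps power2_eq_square)
      finally show False using \<open>d \<noteq> 0\<close> q by (simp add: divide_le_0_iff)
    qed
    then show ?thesis by (simp add: d_def)
  qed
  have repr: "ip r h = b" if rb: "(r, b) \<in> R" for r b
  proof -
    have r: "r \<in> H" using mem[OF rb] .
    (* the imaginary parts are the real parts at \<i> r *)
    have "Re (ip h (\<lambda>x. \<i> * r x)) = Re (\<i> * b)"
      by (rule Re_eq[OF scale[OF rb]])
    then have "Im (ip h r) = - Im b" by (simp add: ip_scale_right[OF r h])
    then show ?thesis using Re_eq[OF rb] ip_cnj[OF h r] by (simp add: complex_eq_iff)
  qed
  have "(hnorm ip h)\<^sup>2 \<le> C * hnorm ip h"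
  proof (rule LIMSEQ_le)
    show "(\<lambda>n. Re (ip (s n) h)) \<longlonglongrightarrow> (hnorm ip h)\<^sup>2"
      unfolding hnorm_square[OF h] by (intro tendsto_intros ip_limit sH h lim)
    have "(\<lambda>n. C * (hnorm ip (\<lambda>x. s n x - h x) + hnorm ip h)) \<longlonglongrightarrow> C * (0 + hnorm ip h)"
      by (intro tendsto_intros lim)
    then show "(\<lambda>n. C * (hnorm ip (\<lambda>x. s n x - h x) + hnorm ip h)) \<longlonglongrightarrow> C * hnorm ip h"
      by simp
    have "Re (ip (s n) h) \<le> C * (hnorm ip (\<lambda>x. s n x - h x) + hnorm ip h)" for n
    proof -
      have "(hnorm ip (\<lambda>x. (s n x - h x) + h x))\<^sup>2 \<le> (hnorm ip (\<lambda>x. s n x - h x) + hnorm ip h)\<^sup>2"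
        using hnorm_add_square[OF diff_mem[OF sH[of n] h] h]
          cauchy_schwarz[OF diff_mem[OF sH[of n] h] h]
          complex_Re_le_cmod[of "ip (\<lambda>x. s n x - h x) h"]
        unfolding power2_sum by linarith
      then have "hnorm ip (s n) \<le> hnorm ip (\<lambda>x. s n x - h x) + hnorm ip h"
        using hnorm_nonneg[OF diff_mem[OF sH[of n] h]] hnorm_nonneg[OF h]
        by - (rule power2_le_imp_le, auto)
      then have "C * hnorm ip (s n) \<le> C * (hnorm ip (\<lambda>x. s n x - h x) + hnorm ip h)"
        using C by (rule mult_left_mono)
      moreover have "Re (ip (s n) h) \<le> C * hnorm ip (s n)"
        using bound[OF sR[of n]] repr[OF sR[of n]] complex_Re_le_cmod[of "a n"] by simp
      ultimately show ?thesis by linarith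
    qed
    then show "\<exists>N. \<forall>n\<ge>N. Re (ip (s n) h) \<le> C * (hnorm ip (\<lambda>x. s n x - h x) + hnorm ip h)"
      by blast
  qed
  then have "hnorm ip h \<le> C"
    using hnorm_nonneg[OF h] C
    by (cases "hnorm ip h = 0") (auto simp: power2_eq_square)
  moreover have "s n \<in> fst ` R" for n using sR[of n] by force
  ultimately show thesis using that[of h s] h repr lim by blast
qed

end

section \<open>Reproducing kernels\<close>

context reproducing_kernel_hilbert_space
begin

definition kernel_section :: "'a \<Rightarrow> 'a \<Rightarrow> complex" where
  "kernel_section w = (\<lambda>x. if x \<in> X then K x w else 0)"

definition kernel_span :: "('a \<Rightarrow> complex) set" where
  "kernel_span = {\<lambda>y. \<Sum>x\<in>F. c x * kernel_section x y | F c. finite F \<and> F \<subseteq> X}"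

lemma kernel_section_mem: "w \<in> X \<Longrightarrow> kernel_section w \<in> H"
  using kernel_mem by (simp add: kernel_section_def)

lemma ip_kernel_section: "f \<in> H \<Longrightarrow> w \<in> X \<Longrightarrow> ip f (kernel_section w) = f w"
  using reproducing by (simp add: kernel_section_def)

lemma combination_mem:
  "finite F \<Longrightarrow> F \<subseteq> X \<Longrightarrow> (\<lambda>y. \<Sum>x\<in>F. c x * kernel_section x y) \<in> H"
  by (intro sum_mem scale_mem kernel_section_mem) auto

lemma ip_combination_left:
  assumes "finite F" "F \<subseteq> X" "f \<in> H"
  shows "ip (\<lambda>y. \<Sum>x\<in>F. c x * kernel_section x y) f = (\<Sum>x\<in>F. c x * cnj (f x))"
proof -
  have "ip (\<lambda>y. c x * kernel_section x y) f = c x * cnj (f x)" if "x \<in> F" for x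
    using that assms ip_cnj[OF assms(3) kernel_section_mem[of x]]
    by (auto simp: ip_scale_left kernel_section_mem ip_kernel_section)
  moreover have "(\<lambda>y. c x * kernel_section x y) \<in> H" if "x \<in> F" for x
    using that assms by (auto intro: scale_mem kernel_section_mem)
  ultimately show ?thesis
    using ip_sum_left[of F "\<lambda>x y. c x * kernel_section x y" f] assms by simp
qed

lemma ip_combination_right:
  assumes "finite F" "F \<subseteq> X" "f \<in> H"
  shows "ip f (\<lambda>y. \<Sum>x\<in>F. c x * kernel_section x y) = (\<Sum>x\<in>F. cnj (c x) * f x)"
  using ip_cnj[OF combination_mem[OF assms(1,2), of c] assms(3)]
    ip_combination_left[OF assms, of c] by simp

lemma ip_combinations:
  assumes "finite F" "F \<subseteq> X"
  shows "ip (\<lambda>y. \<Sum>x\<in>F. c x * kernel_section x y) (\<lambda>y. \<Sum>x\<in>F. d x * kernel_section x y)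
    = (\<Sum>x\<in>F. \<Sum>y\<in>F. cnj (d x) * K x y * c y)"
  using assms
  by (subst ip_combination_right[OF assms combination_mem[OF assms]])
     (auto simp: kernel_section_def sum_distrib_left ac_simps intro!: sum.cong)

text \<open>
  If \<open>G\<close> belonged to \<open>H\<close>, then \<open>f \<mapsto> \<langle>f, G\<rangle>\<close> would send \<open>\<Sum> c\<^sub>x k\<^sub>x\<close> to \<open>\<Sum> c\<^sub>x G(x)\<^sup>*\<close>. Conversely, if the latter
  prescription is bounded on the span of the kernel sections, its Riesz representative takes the values
  of \<open>G\<close>. This is how functions given by integrals are recognized as elements of an abstract
  reproducing kernel Hilbert space, with control of their norms.
\<close>

lemma kernel_membership:
  assumes C: "0 \<le> C"
    and bound: "\<And>F c. finite F \<Longrightarrow> F \<subseteq> X \<Longrightarrow>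
      cmod (\<Sum>x\<in>F. c x * cnj (G x)) \<le> C * hnorm ip (\<lambda>y. \<Sum>x\<in>F. c x * kernel_section x y)"
  obtains h s where "h \<in> H" "hnorm ip h \<le> C" "\<And>x. x \<in> X \<Longrightarrow> h x = G x"
    "\<And>n. s n \<in> kernel_span" "(\<lambda>n. hnorm ip (\<lambda>x. s n x - h x)) \<longlonglongrightarrow> 0"
proof -
  define R where "R = {(\<lambda>y. \<Sum>x\<in>F. c x * kernel_section x y, \<Sum>x\<in>F. c x * cnj (G x)) | F c.
    finite F \<and> F \<subseteq> X}"
  have R: "(\<lambda>y. \<Sum>x\<in>F. c x * kernel_section x y, \<Sum>x\<in>F. c x * cnj (G x)) \<in> R"
    if "finite F" "F \<subseteq> X" for F c
    using that by (auto simp: R_def)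
  have sum_R: "(\<lambda>x. s x + r x, a + b) \<in> R" if sa: "(s, a) \<in> R" and rb: "(r, b) \<in> R" for s a r b
  proof -
    obtain F c where F: "finite F" "F \<subseteq> X" "s = (\<lambda>y. \<Sum>x\<in>F. c x * kernel_section x y)"
        "a = (\<Sum>x\<in>F. c x * cnj (G x))"
      using sa by (auto simp: R_def)
    obtain E d where E: "finite E" "E \<subseteq> X" "r = (\<lambda>y. \<Sum>x\<in>E. d x * kernel_section x y)"
        "b = (\<Sum>x\<in>E. d x * cnj (G x))"
      using rb by (auto simp: R_def)
    (* both combinations are written over the common index set by padding with zeros *)
    define e where "e = (\<lambda>x. (if x \<in> F then c x else 0) + (if x \<in> E then d x else 0))"
    have e: "(\<Sum>x\<in>F \<union> E. e x * u x) = (\<Sum>x\<in>F. c x * u x) + (\<Sum>x\<in>E. d x * u x)" for u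
    proof -
      have "(\<Sum>x\<in>F \<union> E. (if x \<in> F then c x else 0) * u x) = (\<Sum>x\<in>F. c x * u x)"
        "(\<Sum>x\<in>F \<union> E. (if x \<in> E then d x else 0) * u x) = (\<Sum>x\<in>E. d x * u x)"
        using F(1) E(1) by (auto intro!: sum.mono_neutral_cong_right)
      then show ?thesis by (simp add: e_def algebra_simps sum.distrib)
    qed
    show ?thesis
      using R[of "F \<union> E" e] F E by (simp add: e)
  qed
  have scale_R: "(\<lambda>x. c * s x, c * a) \<in> R" if sa: "(s, a) \<in> R" for s a c
  proof -
    obtain F d where F: "finite F" "F \<subseteq> X" "s = (\<lambda>y. \<Sum>x\<in>F. d x * kernel_section x y)"
        "a = (\<Sum>x\<in>F. d x * cnj (G x))"
      using sa by (auto simp: R_def)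
    show ?thesis
      using R[of F "\<lambda>x. c * d x"] F by (simp add: sum_distrib_left mult.assoc)
  qed
  have mem_R: "s \<in> H" if "(s, a) \<in> R" for s a
    using that combination_mem by (auto simp: R_def)
  have ne_R: "R \<noteq> {}" using R[of "{}"] by auto
  have bound_R: "cmod a \<le> C * hnorm ip s" if "(s, a) \<in> R" for s a
    using that bound by (auto simp: R_def)
  obtain h s where h: "h \<in> H" "hnorm ip h \<le> C" "\<And>r a. (r, a) \<in> R \<Longrightarrow> ip r h = a"
    and s: "\<And>n. s n \<in> fst ` R" "(\<lambda>n. hnorm ip (\<lambda>x. s n x - h x)) \<longlonglongrightarrow> 0"
  proof (rule bounded_functional_representation[of R C])
    show "R \<noteq> {}" by (rule ne_R)
    show "0 \<le> C" by (rule C)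
  qed (use mem_R sum_R scale_R bound_R in blast)+
  have "h x = G x" if x: "x \<in> X" for x
  proof -
    have "ip (kernel_section x) h = cnj (G x)"
      using h(3)[OF R[of "{x}" "\<lambda>_. 1"]] x by simp
    then have "cnj (ip h (kernel_section x)) = cnj (G x)"
      using ip_cnj[OF h(1) kernel_section_mem[OF x]] by simp
    then show ?thesis by (simp add: ip_kernel_section[OF h(1) x])
  qed
  moreover have "s n \<in> kernel_span" for n
  proof -
    obtain F c where "finite F" "F \<subseteq> X" "s n = (\<lambda>y. \<Sum>x\<in>F. c x * kernel_section x y)"
      using s(1)[of n] by (auto simp: R_def)
    then show ?thesis unfolding kernel_span_def by blast
  qed
  ultimately show thesis using that[of h s] h s by blast
qed

text \<open>
  The kernel sections span a dense subspace: the membership criterion applied to an \<open>f\<close> in \<open>H\<close> gives back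
  \<open>f\<close>, now as a limit of combinations of kernel sections.
\<close>

lemma functional_zero_of_kernel_sections:
  assumes add: "\<And>f g. f \<in> H \<Longrightarrow> g \<in> H \<Longrightarrow> D (\<lambda>x. f x + g x) = D f + D g"
    and scale: "\<And>f c. f \<in> H \<Longrightarrow> D (\<lambda>x. c * f x) = c * D f"
    and bound: "\<And>f. f \<in> H \<Longrightarrow> cmod (D f) \<le> C * hnorm ip f"
    and zero: "\<And>w. w \<in> X \<Longrightarrow> D (kernel_section w) = 0"
    and f: "f \<in> H"
  shows "D f = 0"
proof -
  have bound_f: "cmod (\<Sum>x\<in>F. c x * cnj (f x))
      \<le> hnorm ip f * hnorm ip (\<lambda>y. \<Sum>x\<in>F. c x * kernel_section x y)"
    if "finite F" "F \<subseteq> X" for F c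
    using cauchy_schwarz[OF combination_mem[OF that] f] ip_combination_left[OF that f]
    by (simp add: mult.commute)
  obtain h s where h: "h \<in> H" "\<And>x. x \<in> X \<Longrightarrow> h x = f x"
    and s: "\<And>n. s n \<in> kernel_span" "(\<lambda>n. hnorm ip (\<lambda>x. s n x - h x)) \<longlonglongrightarrow> 0"
    by (rule kernel_membership[of "hnorm ip f" f]) (use hnorm_nonneg[OF f] bound_f in blast)+
  have "h = f"
  proof
    fix x show "h x = f x"
      using h vanishes[OF h(1), of x] vanishes[OF f, of x] by (cases "x \<in> X") auto
  qed
  have D0: "D (\<lambda>x. 0) = 0" using scale[OF zero_mem, of 0] by simp
  have span: "D (\<lambda>y. \<Sum>x\<in>F. c x * kernel_section x y) = 0" if "finite F" "F \<subseteq> X" for F c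
    using that
  proof (induction F rule: finite_induct)
    case (insert x F)
    then show ?case
      using add[OF scale_mem[OF kernel_section_mem, of x "c x"] combination_mem[of F c]]
        scale[OF kernel_section_mem, of x "c x"] zero[of x] by simp
  qed (simp add: D0)
  have D_s: "D (s n) = 0" "s n \<in> H" for n
    using s(1)[of n] span combination_mem by (auto simp: kernel_span_def)
  have "cmod (D f) \<le> C * hnorm ip (\<lambda>x. s n x - h x)" for n
  proof -
    have "D (\<lambda>x. s n x + (-1) * f x) = - D f"
      using add[OF D_s(2)[of n] scale_mem[OF f, of "-1"]] scale[OF f, of "-1"] D_s by simp
    then show ?thesis
      using bound[OF diff_mem[OF D_s(2)[of n] f]] by (simp add: \<open>h = f\<close>)
  qed
  moreover have "(\<lambda>n. C * hnorm ip (\<lambda>x. s n x - h x)) \<longlonglongrightarrow> C * 0"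
    by (intro tendsto_intros s)
  ultimately have "cmod (D f) \<le> C * 0"
    by (intro LIMSEQ_le_const) auto
  then show ?thesis by simp
qed

end

text \<open>
  The adjoint of multiplication by \<open>h\<close> sends \<open>k\<^sub>x\<close> to \<open>h(x)\<^sup>* k\<^sub>x\<close>, so it maps \<open>s = \<Sum> c\<^sub>x k\<^sub>x\<close> to
  \<open>r = \<Sum> c\<^sub>x h(x)\<^sup>* k\<^sub>x\<close>, and the quadratic form of the kernel is \<open>\<parallel>s\<parallel>\<^sup>2 - \<parallel>r\<parallel>\<^sup>2\<close>. The adjoint itself is not
  constructed: \<open>\<parallel>r\<parallel>\<^sup>2 = \<langle>T r, s\<rangle> \<le> \<parallel>r\<parallel> \<parallel>s\<parallel>\<close> is enough.
\<close>

lemma (in reproducing_kernel_hilbert_space) multiplier_kernel_positive: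
  assumes mem: "\<And>f. f \<in> H \<Longrightarrow> T f \<in> H"
    and contraction: "\<And>f. f \<in> H \<Longrightarrow> hnorm ip (T f) \<le> hnorm ip f"
    and multiplication: "\<And>f x. f \<in> H \<Longrightarrow> x \<in> X \<Longrightarrow> T f x = h x * f x"
  shows "positive_kernel_on X (\<lambda>x y. (1 - h x * cnj (h y)) * K x y)"
  unfolding positive_kernel_on_def
proof (intro allI impI, elim conjE)
  fix F :: "'a set" and c :: "'a \<Rightarrow> complex"
  assume F: "finite F" "F \<subseteq> X"
  define d where "d = (\<lambda>x. c x * cnj (h x))"
  define s where "s = (\<lambda>y. \<Sum>x\<in>F. c x * kernel_section x y)"
  define r where "r = (\<lambda>y. \<Sum>x\<in>F. d x * kernel_section x y)"
  have s: "s \<in> H" and r: "r \<in> H" unfolding s_def r_def by (rule combination_mem[OF F])+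
  have "ip r r = (\<Sum>x\<in>F. cnj (d x) * r x)"
    using ip_combination_right[OF F r, of d] by (simp add: r_def)
  also have "\<dots> = (\<Sum>x\<in>F. cnj (c x) * T r x)"
    using F(2) by (intro sum.cong refl) (auto simp: d_def multiplication[OF r] mult.assoc)
  also have "\<dots> = ip (T r) s"
    using ip_combination_right[OF F mem[OF r], of c] by (simp add: s_def)
  finally have "(hnorm ip r)\<^sup>2 \<le> cmod (ip (T r) s)"
    unfolding hnorm_square[OF r] using complex_Re_le_cmod by simp
  also have "\<dots> \<le> hnorm ip (T r) * hnorm ip s" by (rule cauchy_schwarz[OF mem[OF r] s])
  also have "\<dots> \<le> hnorm ip r * hnorm ip s"
    by (rule mult_right_mono[OF contraction[OF r] hnorm_nonneg[OF s]])
  finally have "hnorm ip r \<le> hnorm ip s"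
    using hnorm_nonneg[OF r] hnorm_nonneg[OF s]
    by (cases "hnorm ip r = 0") (auto simp: power2_eq_square)
  then have le: "(hnorm ip r)\<^sup>2 \<le> (hnorm ip s)\<^sup>2" by (intro power_mono hnorm_nonneg r)
  have "(\<Sum>x\<in>F. \<Sum>y\<in>F. cnj (c x) * ((1 - h x * cnj (h y)) * K x y) * c y)
      = (\<Sum>x\<in>F. \<Sum>y\<in>F. cnj (c x) * K x y * c y) - (\<Sum>x\<in>F. \<Sum>y\<in>F. cnj (d x) * K x y * d y)"
    by (simp add: d_def algebra_simps sum_subtractf)
  also have "\<dots> = of_real ((hnorm ip s)\<^sup>2 - (hnorm ip r)\<^sup>2)"
    unfolding ip_combinations[OF F, symmetric] s_def[symmetric] r_def[symmetric]
    by (simp add: ip_self s r)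
  also have "\<dots> \<in> \<real>\<^sub>\<ge>\<^sub>0" using le by (simp only: nonneg_Reals_of_real_iff diff_ge_0_iff_ge)
  finally show "(\<Sum>x\<in>F. \<Sum>y\<in>F. cnj (c x) * ((1 - h x * cnj (h y)) * K x y) * c y) \<in> \<real>\<^sub>\<ge>\<^sub>0" .
qed

section \<open>Power series in infinitely many variables and the kernel \<open>K\<^sub>k\<close>\<close>

lemma multi_indices_eq: "multi_indices = {\<alpha>. finite {j. \<alpha> j \<noteq> 0}}"
  by (simp add: multi_indices_def cofinite_eq_sequentially[symmetric] eventually_cofinite)

lemma zero_mem_multi_indices: "(\<lambda>_. 0) \<in> multi_indices"
  by (simp add: multi_indices_eq)

lemma mpow_superset:
  assumes "finite S" "{j. \<alpha> j \<noteq> 0} \<subseteq> S"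
  shows "mpow z \<alpha> = (\<Prod>j\<in>S. z j ^ \<alpha> j)"
  unfolding mpow_def using assms by (intro prod.mono_neutral_left) auto

lemma mpow_zero_index [simp]: "mpow z (\<lambda>_. 0) = 1"
  by (simp add: mpow_def)

lemma mpow_mult: "mpow x \<alpha> * mpow y \<alpha> = mpow (\<lambda>j. x j * y j) \<alpha>"
  by (simp add: mpow_def prod.distrib power_mult_distrib)

lemma mpow_scale_index: "mpow x (\<lambda>j. n * \<alpha> j) = mpow (\<lambda>j. x j ^ n) \<alpha>"
  by (cases "n = 0") (simp_all add: mpow_def power_mult)

lemma norm_mpow: "cmod (mpow z \<alpha>) = mpow (\<lambda>j. cmod (z j)) \<alpha>"
  by (simp add: mpow_def prod_norm[symmetric] norm_power)

lemma of_real_mpow: "complex_of_real (mpow x \<alpha>) = mpow (\<lambda>j. of_real (x j)) \<alpha>"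
  by (simp add: mpow_def)

lemma mpow_eq_0:
  fixes z :: "nat \<Rightarrow> complex"
  assumes "\<alpha> \<in> multi_indices" "\<alpha> j \<noteq> 0" "z j = 0"
  shows "mpow z \<alpha> = 0"
  unfolding mpow_def using assms by (intro prod_zero) (auto simp: multi_indices_eq)

lemma mpow_increment:
  assumes "\<alpha> \<in> multi_indices"
  shows "mpow z (\<alpha>(j := Suc (\<alpha> j))) = z j * mpow z \<alpha>"
proof -
  define S where "S = insert j {i. \<alpha> i \<noteq> 0}"
  have S: "finite S" "j \<in> S" using assms by (auto simp: S_def multi_indices_eq)
  have "mpow z (\<alpha>(j := Suc (\<alpha> j))) = (\<Prod>i\<in>S. z i ^ (\<alpha>(j := Suc (\<alpha> j))) i)"
    by (rule mpow_superset) (use S in \<open>auto simp: S_def\<close>)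
  also have "\<dots> = z j ^ Suc (\<alpha> j) * (\<Prod>i\<in>S - {j}. z i ^ \<alpha> i)"
    by (simp add: prod.remove[OF S] cong: prod.cong_simp)
  also have "\<dots> = z j * (\<Prod>i\<in>S. z i ^ \<alpha> i)"
    by (simp add: prod.remove[OF S] mult.assoc)
  also have "(\<Prod>i\<in>S. z i ^ \<alpha> i) = mpow z \<alpha>"
    by (rule mpow_superset[symmetric]) (use S in \<open>auto simp: S_def\<close>)
  finally show ?thesis .
qed

text \<open>
  Formally \<open>mpow_sum \<xi> = \<Prod>\<^sub>j 1 / (1 - \<xi>\<^sub>j)\<close>. Only two consequences of this product formula are needed:
  removing one variable removes one factor, and the product over the variables from the \<open>n\<close>-th on tends
  to 1.
\<close>

definition mpow_sum :: "(nat \<Rightarrow> complex) \<Rightarrow> complex" where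
  "mpow_sum \<xi> = (\<Sum>\<^sub>\<infinity>\<alpha>\<in>multi_indices. mpow \<xi> \<alpha>)"

definition mpow_summable :: "(nat \<Rightarrow> complex) \<Rightarrow> bool" where
  "mpow_summable \<xi> \<longleftrightarrow> (\<lambda>\<alpha>. cmod (mpow \<xi> \<alpha>)) summable_on multi_indices"

lemma mpow_summable_mono:
  assumes "mpow_summable \<xi>" "\<And>j. cmod (\<eta> j) \<le> cmod (\<xi> j)"
  shows "mpow_summable \<eta>"
  using assms(1) unfolding mpow_summable_def
proof (rule Infinite_Sum.abs_summable_on_comparison_test)
  show "cmod (mpow \<eta> \<alpha>) \<le> cmod (mpow \<xi> \<alpha>)" for \<alpha>
    unfolding norm_mpow using assms(2) by (auto simp: mpow_def intro!: prod_mono power_mono)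
qed

lemma mpow_sum_zero: "mpow_sum (\<lambda>_. 0) = 1"
proof -
  have "mpow_sum (\<lambda>_. 0) = (\<Sum>\<^sub>\<infinity>\<alpha>\<in>{\<lambda>_. 0}. mpow (\<lambda>_. 0) \<alpha>)"
    unfolding mpow_sum_def
  proof (rule infsum_cong_neutral)
    fix \<alpha> :: "nat \<Rightarrow> nat" assume a: "\<alpha> \<in> multi_indices - {\<lambda>_. 0}"
    then obtain j where "\<alpha> j \<noteq> 0" by (auto simp: fun_eq_iff)
    then show "mpow (\<lambda>_. 0 :: complex) \<alpha> = 0" using a by (intro mpow_eq_0) auto
  qed (use zero_mem_multi_indices in auto)
  then show ?thesis by simp
qed

text \<open>
  The multi-indices with \<open>\<alpha>\<^sub>j > 0\<close> are the shifts by one in position \<open>j\<close> of all multi-indices, so they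
  contribute \<open>\<xi>\<^sub>j\<close> times the full sum. The others contribute the sum with \<open>\<xi>\<^sub>j\<close> replaced by 0.
\<close>

lemma mpow_sum_set_coordinate_zero:
  assumes "mpow_summable \<xi>"
  shows "mpow_sum (\<xi>(j := 0)) = (1 - \<xi> j) * mpow_sum \<xi>"
proof -
  define A where "A = {\<alpha> \<in> multi_indices. \<alpha> j = 0}"
  define B where "B = {\<alpha> \<in> multi_indices. \<alpha> j \<noteq> 0}"
  define inc where "inc = (\<lambda>\<alpha> :: nat \<Rightarrow> nat. \<alpha>(j := Suc (\<alpha> j)))"
  have summable: "mpow \<xi> summable_on multi_indices"
    using assms unfolding mpow_summable_def by (rule Infinite_Sum.abs_summable_summable)
  have AB: "multi_indices = A \<union> B" "A \<inter> B = {}" by (auto simp: A_def B_def)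
  have "mpow_sum \<xi> = infsum (mpow \<xi>) A + infsum (mpow \<xi>) B"
    unfolding mpow_sum_def AB(1) using summable
    by (intro infsum_Un_disjoint AB(2)) (auto intro: summable_on_subset_banach simp: A_def B_def)
  moreover have "infsum (mpow \<xi>) A = mpow_sum (\<xi>(j := 0))"
    unfolding mpow_sum_def
  proof (rule infsum_cong_neutral)
    fix \<alpha> assume "\<alpha> \<in> multi_indices - A"
    then show "mpow (\<xi>(j := 0)) \<alpha> = 0" by (intro mpow_eq_0[of _ j]) (auto simp: A_def)
  next
    fix \<alpha> assume "\<alpha> \<in> A \<inter> multi_indices"
    then show "mpow \<xi> \<alpha> = mpow (\<xi>(j := 0)) \<alpha>"
      by (auto simp: A_def mpow_def intro!: prod.cong)
  qed (auto simp: A_def)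
  moreover have "infsum (mpow \<xi>) B = \<xi> j * mpow_sum \<xi>"
  proof -
    have "inj_on inc multi_indices"
      by (rule inj_on_inverseI[where g = "\<lambda>\<alpha>. \<alpha>(j := \<alpha> j - 1)"]) (simp add: inc_def)
    moreover have "B = inc ` multi_indices"
    proof (intro equalityI subsetI)
      fix \<alpha> assume a: "\<alpha> \<in> B"
      then have "\<alpha> = inc (\<alpha>(j := \<alpha> j - 1))" by (auto simp: inc_def B_def)
      moreover have "\<alpha>(j := \<alpha> j - 1) \<in> multi_indices"
        using a by (auto simp: B_def multi_indices_eq intro: finite_subset[of _ "{i. \<alpha> i \<noteq> 0}"])
      ultimately show "\<alpha> \<in> inc ` multi_indices" by blast
    next
      fix \<alpha> assume "\<alpha> \<in> inc ` multi_indices"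
      then obtain \<beta> where "finite {i. \<beta> i \<noteq> 0}" "\<alpha> = inc \<beta>" by (auto simp: multi_indices_eq)
      moreover have "{i. inc \<beta> i \<noteq> 0} = insert j {i. \<beta> i \<noteq> 0}" by (auto simp: inc_def)
      ultimately show "\<alpha> \<in> B"
        by (simp add: B_def multi_indices_eq) (simp add: inc_def)
    qed
    ultimately have "infsum (mpow \<xi>) B = infsum (mpow \<xi> \<circ> inc) multi_indices"
      by (simp add: infsum_reindex)
    also have "\<dots> = infsum (\<lambda>\<alpha>. \<xi> j * mpow \<xi> \<alpha>) multi_indices"
      by (rule infsum_cong) (simp add: inc_def mpow_increment)
    finally show ?thesis by (simp add: infsum_cmult_right' mpow_sum_def)
  qed
  ultimately show ?thesis by (simp add: algebra_simps)
qed

definition drop_coordinates :: "nat \<Rightarrow> (nat \<Rightarrow> complex) \<Rightarrow> nat \<Rightarrow> complex" where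
  "drop_coordinates n z = (\<lambda>j. if j < n then 0 else z j)"

lemma drop_coordinates_0 [simp]: "drop_coordinates 0 z = z"
  by (simp add: drop_coordinates_def)

lemma drop_coordinates_Suc: "drop_coordinates (Suc n) z = (drop_coordinates n z)(n := 0)"
  by (auto simp: drop_coordinates_def)

text \<open>
  Dominated convergence, by hand: all but finitely many multi-indices together contribute less than \<open>e\<close>, and
  each of the remaining ones except 0 involves a coordinate that is eventually dropped.
\<close>

lemma mpow_sum_drop_coordinates_tendsto:
  assumes "mpow_summable \<xi>"
  shows "(\<lambda>n. mpow_sum (drop_coordinates n \<xi>)) \<longlonglongrightarrow> 1"
proof (rule tendstoI)
  fix e :: real assume e: "e > 0"
  let ?g = "\<lambda>\<alpha>. cmod (mpow \<xi> \<alpha>)"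
  have g: "?g summable_on multi_indices" using assms by (simp add: mpow_summable_def)
  obtain F where F: "finite F" "F \<subseteq> multi_indices"
      and close: "\<And>Y. finite Y \<Longrightarrow> F \<subseteq> Y \<Longrightarrow> Y \<subseteq> multi_indices \<Longrightarrow>
        dist (sum ?g Y) (infsum ?g multi_indices) < e"
    using tendstoD[OF infsum_tendsto[OF g] e]
    unfolding eventually_finite_subsets_at_top by auto
  define Y where "Y = insert (\<lambda>_. 0) F"
  have Y: "finite Y" "Y \<subseteq> multi_indices" "(\<lambda>_. 0) \<in> Y"
    using F zero_mem_multi_indices by (auto simp: Y_def)
  have gY: "?g summable_on multi_indices - Y"
    using g by (rule summable_on_subset_banach) auto
  have sub: "F \<subseteq> Y" by (auto simp: Y_def)
  have "infsum ?g multi_indices = infsum ?g (Y \<union> (multi_indices - Y))"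
    using Y by (intro arg_cong[of _ _ "infsum ?g"]) auto
  also have "\<dots> = sum ?g Y + infsum ?g (multi_indices - Y)"
    using infsum_Un_disjoint[of ?g Y "multi_indices - Y"] Y gY by (simp add: summable_on_finite)
  finally have rest: "infsum ?g (multi_indices - Y) < e"
    using close[OF Y(1) sub Y(2)] by (simp add: dist_real_def)
  have "\<forall>\<^sub>F n in sequentially. \<forall>\<alpha>\<in>Y - {\<lambda>_. 0}. \<exists>j<n. \<alpha> j \<noteq> 0"
  proof (rule eventually_ball_finite)
    show "\<forall>\<alpha>\<in>Y - {\<lambda>_. 0}. \<forall>\<^sub>F n in sequentially. \<exists>j<n. \<alpha> j \<noteq> 0"
    proof
      fix \<alpha> assume "\<alpha> \<in> Y - {\<lambda>_. 0}"
      then obtain j where "\<alpha> j \<noteq> 0" by (auto simp: fun_eq_iff)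
      then show "\<forall>\<^sub>F n in sequentially. \<exists>j<n. \<alpha> j \<noteq> 0"
        by (intro eventually_mono[OF eventually_gt_at_top[of j]]) auto
    qed
  qed (use Y in simp)
  then show "\<forall>\<^sub>F n in sequentially. dist (mpow_sum (drop_coordinates n \<xi>)) 1 < e"
  proof eventually_elim
    case (elim n)
    let ?f = "mpow (drop_coordinates n \<xi>)"
    have summable: "(\<lambda>\<alpha>. cmod (?f \<alpha>)) summable_on multi_indices"
      using mpow_summable_mono[OF assms, of "drop_coordinates n \<xi>"]
      by (simp add: mpow_summable_def drop_coordinates_def)
    have le: "cmod (?f \<alpha>) \<le> ?g \<alpha>" for \<alpha>
      unfolding norm_mpow by (auto simp: mpow_def drop_coordinates_def intro!: prod_mono power_mono)
    have f0: "?f \<alpha> = 0" if \<alpha>: "\<alpha> \<in> Y - {\<lambda>_. 0}" for \<alpha>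
    proof -
      obtain j where "j < n" "\<alpha> j \<noteq> 0" using elim \<alpha> by auto
      then show ?thesis using \<alpha> Y by (intro mpow_eq_0[of _ j]) (auto simp: drop_coordinates_def)
    qed
    have fY: "(\<lambda>\<alpha>. cmod (?f \<alpha>)) summable_on multi_indices - Y"
      using summable by (rule summable_on_subset_banach) auto
    have "mpow_sum (drop_coordinates n \<xi>) = infsum ?f (Y \<union> (multi_indices - Y))"
      unfolding mpow_sum_def using Y by (intro arg_cong[of _ _ "infsum ?f"]) auto
    also have "\<dots> = sum ?f Y + infsum ?f (multi_indices - Y)"
      using infsum_Un_disjoint[of ?f Y "multi_indices - Y"] Y Infinite_Sum.abs_summable_summable[OF fY]
      by (simp add: summable_on_finite)
    also have "sum ?f Y = sum ?f {\<lambda>_. 0}"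
      using Y f0 by (intro sum.mono_neutral_right) auto
    finally have "dist (mpow_sum (drop_coordinates n \<xi>)) 1 = cmod (infsum ?f (multi_indices - Y))"
      by (simp add: dist_norm)
    also have "\<dots> \<le> infsum (\<lambda>\<alpha>. cmod (?f \<alpha>)) (multi_indices - Y)"
      by (rule norm_infsum_bound[OF fY])
    also have "\<dots> \<le> infsum ?g (multi_indices - Y)"
      using fY gY le by (rule infsum_mono)
    finally show ?case using rest by simp
  qed
qed

definition index_weight :: "nat \<Rightarrow> nat \<Rightarrow> real" where
  "index_weight k j = (2 * real (Suc j)) ^ k"

lemma even_weight_eq: "even_weight k \<alpha> = mpow (index_weight k) \<alpha>"
  unfolding even_weight_def mpow_scale_index by (simp add: mpow_def index_weight_def)

text \<open>
  With this sequence of products, \<open>K\<^sub>k(z, w)\<close> is a power series without weights. At \<open>w = z\<close> the terms are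
  the ones whose summability defines the domain.
\<close>

definition weighted_product :: "nat \<Rightarrow> (nat \<Rightarrow> complex) \<Rightarrow> (nat \<Rightarrow> complex) \<Rightarrow> nat \<Rightarrow> complex" where
  "weighted_product k z w = (\<lambda>j. z j * cnj (w j) * of_real (index_weight k j))"

lemma K_kernel_eq: "K_kernel k z w = mpow_sum (weighted_product k z w)"
  by (simp add: K_kernel_def mpow_sum_def even_weight_eq of_real_mpow mpow_mult weighted_product_def)

lemma index_weight_pos: "index_weight k j > 0"
  by (simp add: index_weight_def)

lemma KK_domain_iff: "z \<in> KK_domain k \<longleftrightarrow> mpow_summable (weighted_product k z z)"
proof -
  have "mpow (\<lambda>j. cmod (z j)) (\<lambda>j. 2 * \<alpha> j) * even_weight k \<alpha>
      = cmod (mpow (weighted_product k z z) \<alpha>)" for \<alpha>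
    using index_weight_pos[of k]
    by (simp add: mpow_scale_index even_weight_eq mpow_mult norm_mpow weighted_product_def
        norm_mult abs_of_pos power2_eq_square)
  then show ?thesis by (simp add: KK_domain_def mpow_summable_def)
qed

text \<open>
  The terms are bounded by the inequality \<open>p q \<le> p\<^sup>2 + q\<^sup>2\<close>, applied to the monomials in \<open>\<bar>z\<bar>\<close> and \<open>\<bar>w\<bar>\<close>.
\<close>

lemma mpow_summable_weighted_product:
  assumes "z \<in> KK_domain k" "w \<in> KK_domain k"
  shows "mpow_summable (weighted_product k z w)"
  unfolding mpow_summable_def
proof (rule Infinite_Sum.abs_summable_on_comparison_test')
  let ?a = "\<lambda>z \<alpha>. cmod (mpow (weighted_product k z z) \<alpha>)"
  show "(\<lambda>\<alpha>. ?a z \<alpha> + ?a w \<alpha>) summable_on multi_indices"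
    using assms by (intro summable_on_add) (auto simp: KK_domain_iff mpow_summable_def)
  fix \<alpha>
  define p where "p = mpow (\<lambda>j. cmod (z j)) \<alpha>"
  define q where "q = mpow (\<lambda>j. cmod (w j)) \<alpha>"
  define r where "r = mpow (index_weight k) \<alpha>"
  have r: "r \<ge> 0"
    unfolding r_def mpow_def by (intro prod_nonneg ballI zero_le_power less_imp_le index_weight_pos)
  have eq: "cmod (mpow (weighted_product k x y) \<alpha>)
      = mpow (\<lambda>j. cmod (x j)) \<alpha> * mpow (\<lambda>j. cmod (y j)) \<alpha> * r" for x y
    using index_weight_pos[of k]
    by (simp add: norm_mpow weighted_product_def norm_mult abs_of_pos mpow_mult r_def)
  have "2 * (p * q) \<le> p * p + q * q" "0 \<le> p * p + q * q"
    using sum_squares_bound[of p q] by (simp_all add: power2_eq_square)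
  then have "p * q \<le> p * p + q * q" by linarith
  then have "p * q * r \<le> (p * p + q * q) * r" using r by (rule mult_right_mono)
  then show "cmod (mpow (weighted_product k z w) \<alpha>) \<le> ?a z \<alpha> + ?a w \<alpha>"
    unfolding eq p_def q_def by (simp add: algebra_simps)
qed

lemma KK_domain_mono:
  assumes "z \<in> KK_domain k" "\<And>j. cmod (w j) \<le> cmod (z j)"
  shows "w \<in> KK_domain k"
  using assms(1) unfolding KK_domain_iff
  by (rule mpow_summable_mono)
     (auto simp: weighted_product_def norm_mult intro!: mult_mono assms(2))

lemma zero_mem_KK_domain: "(\<lambda>_. 0) \<in> KK_domain k"
proof -
  have "(\<lambda>\<alpha>. cmod (mpow (\<lambda>_. 0) \<alpha>)) summable_on multi_indices"
  proof (rule finite_nonzero_values_imp_summable_on, rule finite_subset)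
    show "{\<alpha> \<in> multi_indices. cmod (mpow (\<lambda>_. 0) \<alpha>) \<noteq> 0} \<subseteq> {\<lambda>_. 0}"
      using mpow_eq_0 by (force simp: fun_eq_iff)
  qed simp
  then show ?thesis by (simp add: KK_domain_iff mpow_summable_def weighted_product_def)
qed

lemma KK_domain_drop_coordinates: "z \<in> KK_domain k \<Longrightarrow> drop_coordinates n z \<in> KK_domain k"
  by (erule KK_domain_mono) (simp add: drop_coordinates_def)

lemma K_kernel_zero_right: "K_kernel k z (\<lambda>_. 0) = 1"
  by (simp add: K_kernel_eq weighted_product_def mpow_sum_zero)

lemma K_kernel_zero_left: "K_kernel k (\<lambda>_. 0) w = 1"
  by (simp add: K_kernel_eq weighted_product_def mpow_sum_zero)

lemma K_kernel_set_coordinate_zero: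
  assumes "z \<in> KK_domain k" "u \<in> KK_domain k"
  shows "K_kernel k z (u(j := 0)) = (1 - z j * cnj (u j) * of_real (index_weight k j)) * K_kernel k z u"
proof -
  have "weighted_product k z (u(j := 0)) = (weighted_product k z u)(j := 0)"
    by (auto simp: weighted_product_def)
  then show ?thesis
    using mpow_sum_set_coordinate_zero[OF mpow_summable_weighted_product[OF assms], of j]
    by (simp add: K_kernel_eq) (simp add: weighted_product_def)
qed

lemma K_kernel_drop_coordinates_tendsto:
  assumes "z \<in> KK_domain k" "u \<in> KK_domain k"
  shows "(\<lambda>n. K_kernel k z (drop_coordinates n u)) \<longlonglongrightarrow> 1"
    and "(\<lambda>n. K_kernel k (drop_coordinates n z) (drop_coordinates n u)) \<longlonglongrightarrow> 1"
proof -
  have "weighted_product k z (drop_coordinates n u) = drop_coordinates n (weighted_product k z u)"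
    "weighted_product k (drop_coordinates n z) (drop_coordinates n u)
      = drop_coordinates n (weighted_product k z u)" for n
    by (auto simp: weighted_product_def drop_coordinates_def)
  then show "(\<lambda>n. K_kernel k z (drop_coordinates n u)) \<longlonglongrightarrow> 1"
    "(\<lambda>n. K_kernel k (drop_coordinates n z) (drop_coordinates n u)) \<longlonglongrightarrow> 1"
    using mpow_sum_drop_coordinates_tendsto[OF mpow_summable_weighted_product[OF assms]]
    by (simp_all add: K_kernel_eq)
qed

section \<open>The Szego kernel of the half-plane\<close>

lemma integral_square_bound:
  fixes g :: "real \<Rightarrow> real"
  assumes "continuous_on {0..t} g" "0 \<le> t"
  shows "(integral {0..t} g)\<^sup>2 \<le> t * integral {0..t} (\<lambda>s. (g s)\<^sup>2)"
proof (cases "t = 0")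
  case False
  then have t: "t > 0" using assms(2) by simp
  define I where "I = integral {0..t} g"
  have g: "(g has_integral I) {0..t}"
    unfolding I_def by (intro integrable_integral integrable_continuous_real assms)
  have g2: "((\<lambda>s. (g s)\<^sup>2) has_integral integral {0..t} (\<lambda>s. (g s)\<^sup>2)) {0..t}"
    by (intro integrable_integral integrable_continuous_real continuous_intros assms)
  have const: "((\<lambda>s. (I / t)\<^sup>2) has_integral t * (I / t)\<^sup>2) {0..t}"
    using has_integral_const_real[of "(I / t)\<^sup>2" 0 t] t by simp
  have "((\<lambda>s. (g s)\<^sup>2 - 2 * (I / t) * g s + (I / t)\<^sup>2) has_integral
      (integral {0..t} (\<lambda>s. (g s)\<^sup>2) - 2 * (I / t) * I + t * (I / t)\<^sup>2)) {0..t}"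
    by (intro has_integral_add has_integral_diff has_integral_mult_right g g2 const)
  moreover have "(g s)\<^sup>2 - 2 * (I / t) * g s + (I / t)\<^sup>2 = (g s - I / t)\<^sup>2" for s
    by (simp add: power2_diff)
  ultimately have "0 \<le> integral {0..t} (\<lambda>s. (g s)\<^sup>2) - 2 * (I / t) * I + t * (I / t)\<^sup>2"
    by (auto intro: has_integral_nonneg)
  then show ?thesis using t by (simp add: I_def[symmetric] field_simps power2_eq_square)
qed simp

lemma has_integral_exp_linear:
  fixes c :: complex
  assumes "c \<noteq> 0" "0 \<le> t"
  shows "((\<lambda>s. exp (c * of_real s)) has_integral (exp (c * of_real t) - 1) / c) {0..t}"
proof -
  have "((\<lambda>s. exp (c * of_real s)) has_integral
      exp (c * of_real t) / c - exp (c * of_real 0) / c) {0..t}"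
  proof (rule fundamental_theorem_of_calculus[OF assms(2)])
    fix s :: real
    have "((\<lambda>z. exp (c * z) / c) has_field_derivative exp (c * of_real s)) (at (of_real s))"
      using assms(1) by (auto intro!: derivative_eq_intros)
    then show "((\<lambda>s. exp (c * of_real s) / c) has_vector_derivative exp (c * of_real s)) (at s within {0..t})"
      by (rule has_vector_derivative_real_field)
  qed
  then show ?thesis by (simp add: diff_divide_distrib)
qed

text \<open>
  The derivative of the exponential function is at most 1 in modulus on the left half-plane, which is convex.
\<close>

lemma exp_diff_le:
  fixes a b :: complex
  assumes "Re a \<le> 0" "Re b \<le> 0"
  shows "cmod (exp a - exp b) \<le> cmod (a - b)"
proof -
  have "cmod (exp a - exp b) \<le> 1 * cmod (a - b)"
  proof (rule field_differentiable_bound[where S = "{z. Re z \<le> 0}" and f' = exp])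
    show "convex {z. Re z \<le> 0}" by (rule convex_halfspace_Re_le)
  qed (use assms in \<open>auto intro!: derivative_eq_intros\<close>)
  then show ?thesis by simp
qed

definition half_plane_kernel :: "complex \<times> 'b \<Rightarrow> complex \<times> 'b \<Rightarrow> complex" where
  "half_plane_kernel x y = 1 / (- \<i> * (fst x - cnj (fst y)))"

text \<open>
  The first component of a point is its half-plane coordinate. The second one is carried along because
  functions on a product that depend only on the first coordinate are a case of interest; the kernel may
  then be degenerate on \<open>X\<close>.
\<close>

locale half_plane_rkhs = reproducing_kernel_hilbert_space X H ip half_plane_kernel
  for X :: "(complex \<times> 'b) set" and H ip +
  assumes upper: "x \<in> X \<Longrightarrow> Im (fst x) > 0"
begin

lemma difference_nonzero: "x \<in> X \<Longrightarrow> y \<in> X \<Longrightarrow> fst x - cnj (fst y) \<noteq> 0"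
  using upper[of x] upper[of y] by (auto simp: complex_eq_iff)

text \<open>
  The kernel is \<open>\<integral> e\<^bsup>is\<lambda>\<^esup> (e\<^bsup>is\<nu>\<^esup>)\<^sup>* ds\<close> over \<open>[0, \<infinity>)\<close>, so the squared norm of a combination of kernel sections is
  the integral of \<open>\<bar>\<Sum> c\<^sub>x\<^sup>* e\<^bsup>is\<lambda>\<^esup>\<bar>\<^sup>2\<close> over \<open>[0, \<infinity>)\<close>. The part over \<open>[t, \<infinity>)\<close> is itself such a squared norm, with the
  coefficients \<open>d\<close> below, and dropping it gives the inequality. This way only integrals over \<open>[0, t]\<close> occur.
\<close>

lemma energy_bound:
  assumes F: "finite F" "F \<subseteq> X" and t: "0 \<le> t"
  shows "integral {0..t} (\<lambda>s. (cmod (\<Sum>x\<in>F. cnj (c x) * exp (\<i> * of_real s * fst x)))\<^sup>2)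
    \<le> (hnorm ip (\<lambda>y. \<Sum>x\<in>F. c x * kernel_section x y))\<^sup>2"
proof -
  define d where "d = (\<lambda>x. c x * cnj (exp (\<i> * of_real t * fst x)))"
  define A where "A = (\<lambda>(x :: complex \<times> 'b) (y :: complex \<times> 'b). \<i> * (fst x - cnj (fst y)))"
  define E where "E = (\<lambda>s :: real. \<Sum>x\<in>F. cnj (c x) * exp (\<i> * of_real s * fst x))"
  let ?n = "\<lambda>c. hnorm ip (\<lambda>y. \<Sum>x\<in>F. c x * kernel_section x y)"
  have norm_sum: "of_real ((?n c)\<^sup>2) = (\<Sum>x\<in>F. \<Sum>y\<in>F. cnj (c x) * (- 1 / A x y) * c y)" for c
    unfolding ip_self[OF combination_mem[OF F], symmetric] ip_combinations[OF F]
    by (simp add: A_def half_plane_kernel_def)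
  have A_nonzero: "A x y \<noteq> 0" if "x \<in> F" "y \<in> F" for x y
    using difference_nonzero[of x y] subsetD[OF F(2) that(1)] subsetD[OF F(2) that(2)] by (simp add: A_def)
  have split: "exp (\<i> * of_real s * fst x) * cnj (exp (\<i> * of_real s * fst y)) = exp (A x y * of_real s)"
    for s x y
    by (simp add: A_def exp_cnj exp_add[symmetric] algebra_simps)
  have E_square: "of_real ((cmod (E s))\<^sup>2)
      = (\<Sum>x\<in>F. \<Sum>y\<in>F. cnj (c x) * c y * exp (A x y * of_real s))" for s
    unfolding complex_norm_square split[symmetric]
    unfolding E_def cnj_sum sum_product by (intro sum.cong refl) (simp add: ac_simps)
  have "((\<lambda>s. \<Sum>x\<in>F. \<Sum>y\<in>F. cnj (c x) * c y * exp (A x y * of_real s)) has_integral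
     (\<Sum>x\<in>F. \<Sum>y\<in>F. cnj (c x) * c y * ((exp (A x y * of_real t) - 1) / A x y))) {0..t}"
    using F(1) t A_nonzero
    by (intro has_integral_sum has_integral_mult_right has_integral_exp_linear) simp_all
  moreover have "(\<Sum>x\<in>F. \<Sum>y\<in>F. cnj (c x) * c y * ((exp (A x y * of_real t) - 1) / A x y))
      = of_real ((?n c)\<^sup>2 - (?n d)\<^sup>2)"
    unfolding of_real_diff norm_sum sum_subtractf[symmetric] split[symmetric]
    by (intro sum.cong refl) (simp add: d_def diff_divide_distrib algebra_simps)
  ultimately have "((\<lambda>s. complex_of_real ((cmod (E s))\<^sup>2)) has_integral of_real ((?n c)\<^sup>2 - (?n d)\<^sup>2)) {0..t}"
    unfolding E_square by simp
  then have "((Re \<circ> (\<lambda>s. complex_of_real ((cmod (E s))\<^sup>2))) has_integral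
      Re (of_real ((?n c)\<^sup>2 - (?n d)\<^sup>2))) {0..t}"
    by (rule has_integral_linear[OF _ bounded_linear_Re])
  then have "((\<lambda>s. (cmod (E s))\<^sup>2) has_integral ((?n c)\<^sup>2 - (?n d)\<^sup>2)) {0..t}"
    by (simp add: o_def)
  then have "integral {0..t} (\<lambda>s. (cmod (E s))\<^sup>2) = (?n c)\<^sup>2 - (?n d)\<^sup>2"
    by (rule integral_unique)
  then show ?thesis by (simp add: E_def)
qed

text \<open>
  Half of the Paley--Wiener theorem: the Fourier transform of a function supported in \<open>[0, t]\<close> lies in the
  Hardy space. The membership criterion reduces it to \<open>energy_bound\<close> and the Cauchy--Schwarz
  inequality on \<open>[0, t]\<close>.
\<close>

lemma transform_mem:
  fixes b :: "real \<Rightarrow> complex"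
  assumes b: "continuous_on {0..t} b" "\<And>s. 0 \<le> s \<Longrightarrow> s \<le> t \<Longrightarrow> cmod (b s) \<le> B"
    and t: "0 \<le> t"
  obtains h where "h \<in> H" "hnorm ip h \<le> B * sqrt t"
    "\<And>x. x \<in> X \<Longrightarrow> h x = integral {0..t} (\<lambda>s. b s * exp (\<i> * of_real s * fst x))"
proof -
  define G where "G = (\<lambda>x :: complex \<times> 'b. integral {0..t} (\<lambda>s. b s * exp (\<i> * of_real s * fst x)))"
  have B: "0 \<le> B" using b(2)[of 0] t norm_ge_zero[of "b 0"] by linarith
  have bound: "cmod (\<Sum>x\<in>F. c x * cnj (G x))
      \<le> B * sqrt t * hnorm ip (\<lambda>y. \<Sum>x\<in>F. c x * kernel_section x y)"
    if F: "finite F" "F \<subseteq> X" for F c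
  proof -
    define E where "E = (\<lambda>s :: real. \<Sum>x\<in>F. cnj (c x) * exp (\<i> * of_real s * fst x))"
    have E: "continuous_on {0..t} E" unfolding E_def by (intro continuous_intros)
    have "((\<lambda>s. \<Sum>x\<in>F. cnj (c x) * (b s * exp (\<i> * of_real s * fst x))) has_integral
        (\<Sum>x\<in>F. cnj (c x) * G x)) {0..t}"
      unfolding G_def using F
      by (intro has_integral_sum has_integral_mult_right integrable_integral
          integrable_continuous_real continuous_intros b)
    then have "((\<lambda>s. b s * E s) has_integral (\<Sum>x\<in>F. cnj (c x) * G x)) {0..t}"
      by (simp add: E_def sum_distrib_left mult.left_commute)
    then have "cmod (\<Sum>x\<in>F. cnj (c x) * G x) = cmod (integral {0..t} (\<lambda>s. b s * E s))"
      by (simp add: integral_unique)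
    also have "\<dots> \<le> integral {0..t} (\<lambda>s. B * cmod (E s))"
      using b(2) by (intro integral_norm_bound_integral integrable_continuous_real
          continuous_intros b E) (auto simp: norm_mult intro!: mult_right_mono)
    also have "\<dots> = B * integral {0..t} (\<lambda>s. cmod (E s))" by simp
    also have "\<dots> \<le> B * (sqrt t * hnorm ip (\<lambda>y. \<Sum>x\<in>F. c x * kernel_section x y))"
    proof (rule mult_left_mono[OF _ B], rule power2_le_imp_le)
      have "(integral {0..t} (\<lambda>s. cmod (E s)))\<^sup>2 \<le> t * integral {0..t} (\<lambda>s. (cmod (E s))\<^sup>2)"
        by (intro integral_square_bound continuous_intros E t)
      also have "\<dots> \<le> t * (hnorm ip (\<lambda>y. \<Sum>x\<in>F. c x * kernel_section x y))\<^sup>2"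
        using energy_bound[OF F t, of c] t by (intro mult_left_mono) (auto simp: E_def)
      finally show "(integral {0..t} (\<lambda>s. cmod (E s)))\<^sup>2
          \<le> (sqrt t * hnorm ip (\<lambda>y. \<Sum>x\<in>F. c x * kernel_section x y))\<^sup>2"
        using t by (simp add: power_mult_distrib)
    qed (use t hnorm_nonneg[OF combination_mem[OF F]] in simp)
    also have "cmod (\<Sum>x\<in>F. cnj (c x) * G x) = cmod (cnj (\<Sum>x\<in>F. c x * cnj (G x)))"
      by simp
    finally show ?thesis by (simp only: complex_mod_cnj mult.assoc)
  qed
  have B': "0 \<le> B * sqrt t" using B t by simp
  obtain h where "h \<in> H" "hnorm ip h \<le> B * sqrt t" "\<And>x. x \<in> X \<Longrightarrow> h x = G x"
    by (rule kernel_membership[of "B * sqrt t" G]) (use B' bound in blast)+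
  then show thesis using that by (simp add: G_def)
qed

text \<open>
  This is \<open>\<integral> e\<^bsup>is(\<lambda> - w\<^sup>*)\<^esup> ds\<close> over \<open>[0, t]\<close>, a truncation of the integral over \<open>[0, \<infinity>)\<close> that gives the kernel section
  at \<open>w\<close>. Written without an integral it relates the kernel section to its product with \<open>\<chi>\<^sub>t\<close>.
\<close>

definition truncation :: "real \<Rightarrow> complex \<times> 'b \<Rightarrow> complex \<times> 'b \<Rightarrow> complex" where
  "truncation t w = (\<lambda>x. kernel_section w x
     - exp (- \<i> * of_real t * cnj (fst w)) * (chi t (fst x) * kernel_section w x))"

lemma integral_truncation:
  assumes "w \<in> X" "x \<in> X" "0 \<le> t"
  shows "((\<lambda>s. exp (- \<i> * of_real s * cnj (fst w)) * exp (\<i> * of_real s * fst x))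
    has_integral truncation t w x) {0..t}"
proof -
  define a where "a = \<i> * (fst x - cnj (fst w))"
  have a: "a \<noteq> 0" using difference_nonzero[OF assms(2,1)] by (simp add: a_def)
  have eq: "exp (- \<i> * of_real s * cnj (fst w)) * exp (\<i> * of_real s * fst x) = exp (a * of_real s)" for s
    by (simp add: a_def exp_add[symmetric] algebra_simps)
  have "kernel_section w x = - 1 / a"
    using assms by (simp add: kernel_section_def a_def half_plane_kernel_def)
  moreover have "truncation t w x = kernel_section w x * (1 - exp (a * of_real t))"
    unfolding eq[symmetric] by (simp add: truncation_def chi_def algebra_simps)
  ultimately have "truncation t w x = (exp (a * of_real t) - 1) / a"
    by (simp add: diff_divide_distrib)
  then show ?thesis
    unfolding eq using has_integral_exp_linear[OF a assms(3)] by simp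
qed

lemma cmod_exp_conjugate_le:
  "w \<in> X \<Longrightarrow> 0 \<le> s \<Longrightarrow> Re (- \<i> * of_real s * cnj (fst w)) \<le> 0"
  using upper[of w] by simp

lemma truncation_outside: "x \<notin> X \<Longrightarrow> truncation t w x = 0"
  by (simp add: truncation_def kernel_section_def)

lemma truncation_mem:
  assumes "w \<in> X" "0 \<le> t"
  shows "truncation t w \<in> H"
proof -
  let ?b = "\<lambda>s :: real. exp (- \<i> * of_real s * cnj (fst w))"
  have b_le: "cmod (?b s) \<le> 1" if "0 \<le> s" "s \<le> t" for s
    using cmod_exp_conjugate_le[OF assms(1) that(1)] by simp
  have b_cont: "continuous_on {0..t} ?b" by (intro continuous_intros)
  obtain h where h: "h \<in> H" "\<And>x. x \<in> X \<Longrightarrow>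
      h x = integral {0..t} (\<lambda>s. exp (- \<i> * of_real s * cnj (fst w)) * exp (\<i> * of_real s * fst x))"
    using transform_mem[OF b_cont b_le assms(2)] by blast
  have "h = truncation t w"
  proof
    fix x
    show "h x = truncation t w x"
      using h integral_unique[OF integral_truncation[OF assms(1) _ assms(2), of x]]
        vanishes[OF h(1), of x] truncation_outside[of x t w]
      by (cases "x \<in> X") auto
  qed
  then show ?thesis using h(1) by simp
qed

text \<open>
  One truncation has norm of order \<open>t\<^bsup>1/2\<^esup>\<close>, but the integrands at \<open>w\<close> and \<open>v\<close> agree at \<open>s = 0\<close>, which gains
  a factor \<open>t\<close> in their difference. Hence the difference is \<open>o(t)\<close>.
\<close>

lemma truncation_diff_bound:
  assumes "w \<in> X" "v \<in> X" "0 \<le> t"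
  shows "hnorm ip (\<lambda>x. truncation t w x - truncation t v x) \<le> cmod (fst w - fst v) * t * sqrt t"
proof -
  define b where "b = (\<lambda>s :: real. exp (- \<i> * of_real s * cnj (fst w)) - exp (- \<i> * of_real s * cnj (fst v)))"
  have b_cont: "continuous_on {0..t} b" unfolding b_def by (intro continuous_intros)
  have b_le: "cmod (b s) \<le> cmod (fst w - fst v) * t" if s: "0 \<le> s" "s \<le> t" for s
  proof -
    have "cmod (b s) \<le> cmod (- \<i> * of_real s * cnj (fst w) - (- \<i> * of_real s * cnj (fst v)))"
      unfolding b_def
      by (rule exp_diff_le[OF cmod_exp_conjugate_le cmod_exp_conjugate_le]) (use assms s in auto)
    also have "\<dots> = cmod (- \<i> * of_real s * cnj (fst w - fst v))" by (simp add: algebra_simps)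
    also have "\<dots> = s * cmod (fst w - fst v)"
      using s unfolding norm_mult complex_mod_cnj by simp
    also have "\<dots> \<le> cmod (fst w - fst v) * t" using s by (simp add: mult.commute mult_right_mono)
    finally show ?thesis .
  qed
  obtain h where h: "h \<in> H" "hnorm ip h \<le> cmod (fst w - fst v) * t * sqrt t"
    "\<And>x. x \<in> X \<Longrightarrow> h x = integral {0..t} (\<lambda>s. b s * exp (\<i> * of_real s * fst x))"
    using transform_mem[OF b_cont b_le assms(3)] by blast
  have "h = (\<lambda>x. truncation t w x - truncation t v x)"
  proof
    fix x
    show "h x = truncation t w x - truncation t v x"
    proof (cases "x \<in> X")
      case True
      have "((\<lambda>s. b s * exp (\<i> * of_real s * fst x)) has_integral
          truncation t w x - truncation t v x) {0..t}"
        using has_integral_diff[OF integral_truncation[OF assms(1) True assms(3)]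
            integral_truncation[OF assms(2) True assms(3)]]
        by (simp add: b_def algebra_simps)
      then show ?thesis using h(3)[OF True] by (simp add: integral_unique)
    qed (use vanishes[OF h(1)] truncation_outside in simp)
  qed
  then show ?thesis using h(2) by simp
qed

lemma chi_kernel_section:
  "(\<lambda>x. chi t (fst x) * kernel_section w x)
    = (\<lambda>x. exp (\<i> * of_real t * cnj (fst w)) * (kernel_section w x - truncation t w x))"
  by (simp add: truncation_def exp_minus field_simps)

lemma chi_kernel_section_mem:
  "w \<in> X \<Longrightarrow> 0 \<le> t \<Longrightarrow> (\<lambda>x. chi t (fst x) * kernel_section w x) \<in> H"
  unfolding chi_kernel_section
  by (intro scale_mem diff_mem kernel_section_mem truncation_mem)

text \<open>
  Applied to the truncation at \<open>w\<close>, the functional gives \<open>(1 - e\<^bsup>it(\<nu> - w\<^sup>*)\<^esup>) L(k\<^sub>w)\<close>. By the previous estimate the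
  values for \<open>w\<close> and \<open>v\<close> differ by \<open>o(t)\<close>; dividing by \<open>t\<close> and letting \<open>t \<rightarrow> 0\<close> gives the identity, which
  says that \<open>L\<close> is proportional to evaluation at \<open>\<nu>\<close> on the kernel sections. That
  \<open>\<chi>\<^sub>t k\<^sub>w\<close> is in \<open>H\<close>, so that the linearity of \<open>L\<close> applies to it, is \<open>chi_kernel_section_mem\<close>.
\<close>

lemma eigenfunctional_on_kernel_sections:
  assumes add: "\<And>f g. f \<in> H \<Longrightarrow> g \<in> H \<Longrightarrow> L (\<lambda>x. f x + g x) = L f + L g"
    and scale: "\<And>f c. f \<in> H \<Longrightarrow> L (\<lambda>x. c * f x) = c * L f"
    and bound: "\<And>f. f \<in> H \<Longrightarrow> cmod (L f) \<le> C * hnorm ip f"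
    and eigen: "\<And>f t. f \<in> H \<Longrightarrow> 0 \<le> t \<Longrightarrow> L (\<lambda>x. chi t (fst x) * f x) = chi t \<nu> * L f"
    and C: "0 \<le> C" and w: "w \<in> X" and v: "v \<in> X"
  shows "(\<nu> - cnj (fst w)) * L (kernel_section w) = (\<nu> - cnj (fst v)) * L (kernel_section v)"
proof -
  have L_diff: "L (\<lambda>x. f x - g x) = L f - L g" if "f \<in> H" "g \<in> H" for f g
    using add[OF that(1) scale_mem[OF that(2), of "-1"]] scale[OF that(2), of "-1"] by simp
  define a where "a = (\<lambda>w :: complex \<times> 'b. \<i> * (\<nu> - cnj (fst w)))"
  have L_truncation: "L (truncation t w) = - (exp (a w * of_real t) - 1) * L (kernel_section w)"
    if "w \<in> X" "0 \<le> t" for w t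
  proof -
    have "L (truncation t w) = L (kernel_section w)
        - exp (- \<i> * of_real t * cnj (fst w)) * (chi t \<nu> * L (kernel_section w))"
      unfolding truncation_def using that
      by (simp add: L_diff scale eigen scale_mem kernel_section_mem chi_kernel_section_mem)
    also have "exp (- \<i> * of_real t * cnj (fst w)) * (chi t \<nu> * L (kernel_section w))
        = exp (- \<i> * of_real t * cnj (fst w)) * chi t \<nu> * L (kernel_section w)"
      by (rule mult.assoc[symmetric])
    also have "exp (- \<i> * of_real t * cnj (fst w)) * chi t \<nu> = exp (a w * of_real t)"
      by (simp add: chi_def a_def exp_add[symmetric] algebra_simps)
    finally show ?thesis by (simp add: algebra_simps)
  qed
  define A where "A = (\<lambda>t :: real. (exp (a w * of_real t) - 1) / of_real t * L (kernel_section w)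
      - (exp (a v * of_real t) - 1) / of_real t * L (kernel_section v))"
  define M where "M = C * cmod (fst w - fst v)"
  have A_le: "cmod (A t) \<le> M * sqrt t" if t: "0 < t" for t
  proof -
    have "A t * of_real t = (exp (a w * of_real t) - 1) * L (kernel_section w)
        - (exp (a v * of_real t) - 1) * L (kernel_section v)"
    proof -
      have "(p / T * x - q / T * y) * T = p * x - q * y" if "T \<noteq> 0" for p q x y T :: complex
        using that by (simp add: field_simps)
      then show ?thesis using t by (simp add: A_def)
    qed
    also have "\<dots> = - L (\<lambda>x. truncation t w x - truncation t v x)"
      using t w v by (simp add: L_diff truncation_mem L_truncation algebra_simps)
    finally have "cmod (A t) * t = cmod (L (\<lambda>x. truncation t w x - truncation t v x))"
      using t by (metis abs_of_pos norm_minus_cancel norm_mult norm_of_real)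
    also have "\<dots> \<le> C * hnorm ip (\<lambda>x. truncation t w x - truncation t v x)"
      using t w v by (intro bound diff_mem truncation_mem) auto
    also have "\<dots> \<le> C * (cmod (fst w - fst v) * t * sqrt t)"
      using t w v C by (intro mult_left_mono truncation_diff_bound) auto
    also have "\<dots> = M * sqrt t * t" by (simp add: M_def)
    finally show ?thesis using t by simp
  qed
  define r where "r = (\<lambda>n. inverse (real (Suc n)))"
  have r: "r \<longlonglongrightarrow> 0" "\<And>n. r n > 0"
    using LIMSEQ_inverse_real_of_nat by (simp_all add: r_def)
  have quotient: "(\<lambda>n. (exp (c * of_real (r n)) - 1) / of_real (r n)) \<longlonglongrightarrow> c" for c :: complex
  proof -
    have "((\<lambda>z. exp (c * z)) has_field_derivative c) (at 0)"
      by (auto intro!: derivative_eq_intros)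
    then have "((\<lambda>h. (exp (c * h) - 1) / h) \<longlongrightarrow> c) (at 0)"
      by (simp add: DERIV_def)
    moreover have "filterlim (\<lambda>n. complex_of_real (r n)) (at 0) sequentially"
      unfolding filterlim_at using r(2) tendsto_of_real[OF r(1), where 'a = complex]
      by (auto simp: less_imp_neq[symmetric] intro!: always_eventually dest: less_imp_neq)
    ultimately show ?thesis by (rule filterlim_compose)
  qed
  have "(\<lambda>n. A (r n)) \<longlonglongrightarrow> a w * L (kernel_section w) - a v * L (kernel_section v)"
    unfolding A_def by (intro tendsto_intros quotient)
  moreover have "(\<lambda>n. A (r n)) \<longlonglongrightarrow> 0"
  proof (rule Lim_null_comparison)
    show "\<forall>\<^sub>F n in sequentially. norm (A (r n)) \<le> M * sqrt (r n)"
      using A_le r(2) by simp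
    show "(\<lambda>n. M * sqrt (r n)) \<longlonglongrightarrow> 0"
      using tendsto_mult_right_zero[OF tendsto_real_sqrt[OF r(1), simplified], of M] by simp
  qed
  ultimately have "a w * L (kernel_section w) - a v * L (kernel_section v) = 0"
    by (rule LIMSEQ_unique)
  then have "\<i> * ((\<nu> - cnj (fst w)) * L (kernel_section w))
      = \<i> * ((\<nu> - cnj (fst v)) * L (kernel_section v))"
    by (simp add: a_def algebra_simps)
  then show ?thesis by (subst (asm) mult_cancel_left) simp
qed

end

section \<open>Eigenfunctionals on the tensor product\<close>

lemma mem_tensor_domain: "(l, z) \<in> tensor_domain k \<longleftrightarrow> l \<in> upper_half_plane \<and> z \<in> KK_domain k"
  by (simp add: tensor_domain_def)

lemma tensor_kernel_apply:
  "tensor_kernel k (l, z) (n, w) = K_kernel k z w / (- \<i> * (l - cnj n))"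
  by (simp add: tensor_kernel_def)

locale hardy_tensor_space =
  reproducing_kernel_hilbert_space "tensor_domain k" H ip "tensor_kernel k"
  for k :: nat and H ip
begin

definition z_independent_functions :: "(complex \<times> (nat \<Rightarrow> complex) \<Rightarrow> complex) set" where
  "z_independent_functions = {f \<in> H. \<forall>l. \<forall>z\<in>KK_domain k. f (l, z) = f (l, \<lambda>_. 0)}"

lemma tensor_kernel_zero:
  "tensor_kernel k x (fst w, \<lambda>_. 0) = half_plane_kernel x w"
  by (cases x) (simp add: tensor_kernel_apply half_plane_kernel_def K_kernel_zero_right)

text \<open>
  Since \<open>K\<^sub>k(z, 0) = 1\<close>, the kernel sections at \<open>(n, 0)\<close> are independent of \<open>z\<close>, and by the reproducing property
  they evaluate every function that is constant in \<open>z\<close> at all points \<open>(n, w)\<close>. So these functions form a copy of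
  the Hardy space, to which the results on the half-plane apply.
\<close>

lemma z_independent_functions_half_plane_rkhs:
  "half_plane_rkhs (tensor_domain k) z_independent_functions ip"
proof unfold_locales
  fix w assume w: "w \<in> tensor_domain k"
  have section_eq: "(\<lambda>x. if x \<in> tensor_domain k then half_plane_kernel x w else 0)
      = kernel_section (fst w, \<lambda>_. 0)"
    by (rule ext) (simp add: kernel_section_def tensor_kernel_zero)
  have w0: "(fst w, \<lambda>_. 0) \<in> tensor_domain k"
    using w zero_mem_KK_domain by (cases w) (simp add: mem_tensor_domain)
  show "(\<lambda>x. if x \<in> tensor_domain k then half_plane_kernel x w else 0) \<in> z_independent_functions"
    using kernel_section_mem[OF w0] zero_mem_KK_domain unfolding section_eq
    by (auto simp: z_independent_functions_def kernel_section_def mem_tensor_domain tensor_kernel_apply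
        K_kernel_zero_right)
  fix f assume "f \<in> z_independent_functions"
  then show "ip f (\<lambda>x. if x \<in> tensor_domain k then half_plane_kernel x w else 0) = f w"
    using ip_kernel_section[OF _ w0] w unfolding section_eq
    by (cases w) (auto simp: z_independent_functions_def mem_tensor_domain)
next
  show "0 < Im (fst x)" if "x \<in> tensor_domain k" for x
    using that by (cases x) (simp add: mem_tensor_domain upper_half_plane_def)
next
  fix s :: "nat \<Rightarrow> complex \<times> (nat \<Rightarrow> complex) \<Rightarrow> complex"
  assume s: "\<And>n. s n \<in> z_independent_functions"
    and cauchy: "\<And>e. e > 0 \<Longrightarrow> \<exists>N. \<forall>m\<ge>N. \<forall>n\<ge>N. hnorm ip (\<lambda>x. s m x - s n x) < e"
  have sH: "s n \<in> H" for n using s[of n] by (simp add: z_independent_functions_def)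
  obtain f where f: "f \<in> H" "(\<lambda>n. hnorm ip (\<lambda>x. s n x - f x)) \<longlonglongrightarrow> 0"
    using complete[OF sH cauchy] by blast
  have point: "(\<lambda>n. s n x) \<longlonglongrightarrow> f x" if "x \<in> tensor_domain k" for x
    using ip_limit[OF sH f(1) kernel_section_mem[OF that] f(2)]
    by (simp add: ip_kernel_section[OF _ that] sH f(1))
  have "f (l, z) = f (l, \<lambda>_. 0)" if z: "z \<in> KK_domain k" for l z
  proof (cases "l \<in> upper_half_plane")
    case True
    have "(\<lambda>n. s n (l, z)) \<longlonglongrightarrow> f (l, z)" "(\<lambda>n. s n (l, \<lambda>_. 0)) \<longlonglongrightarrow> f (l, \<lambda>_. 0)"
      using True z zero_mem_KK_domain by (auto intro!: point simp: mem_tensor_domain)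
    moreover have "s n (l, z) = s n (l, \<lambda>_. 0)" for n
      using s[of n] z by (simp add: z_independent_functions_def)
    ultimately show ?thesis by (simp add: LIMSEQ_unique)
  next
    case False
    then show ?thesis using vanishes[OF f(1)] by (simp add: mem_tensor_domain)
  qed
  then show "\<exists>f\<in>z_independent_functions. (\<lambda>n. hnorm ip (\<lambda>x. s n x - f x)) \<longlonglongrightarrow> 0"
    using f by (auto simp: z_independent_functions_def)
qed (auto simp: z_independent_functions_def vanishes zero_mem intro: add_mem scale_mem ip_add_left
    ip_scale_left ip_cnj ip_nonneg ip_definite)

lemma z_independent_functions_subset: "z_independent_functions \<subseteq> H"
  by (auto simp: z_independent_functions_def)

end

text \<open>
  The functional \<open>f \<mapsto> (T f)(\<nu>, w)\<close> is the instance of interest. The aim is \<open>L_eq_evaluation\<close>: evaluation at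
  \<open>(\<nu>, w)\<close> is the only functional of this kind, up to a scalar.
\<close>

locale coordinate_eigenfunctional = hardy_tensor_space +
  fixes L :: "(complex \<times> (nat \<Rightarrow> complex) \<Rightarrow> complex) \<Rightarrow> complex"
    and C :: real and \<nu> :: complex and w :: "nat \<Rightarrow> complex"
  assumes L_add: "f \<in> H \<Longrightarrow> g \<in> H \<Longrightarrow> L (\<lambda>x. f x + g x) = L f + L g"
    and L_scale: "f \<in> H \<Longrightarrow> L (\<lambda>x. c * f x) = c * L f"
    and L_bound: "f \<in> H \<Longrightarrow> cmod (L f) \<le> C * hnorm ip f"
    and L_chi: "f \<in> H \<Longrightarrow> 0 \<le> t \<Longrightarrow> L (\<lambda>x. chi t (fst x) * f x) = chi t \<nu> * L f"
    and L_coordinate: "f \<in> H \<Longrightarrow> L (\<lambda>x. snd x j * f x) = w j * L f"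
    and C_nonneg: "0 \<le> C"
    and point: "(\<nu>, w) \<in> tensor_domain k"
begin

lemma L_diff: "f \<in> H \<Longrightarrow> g \<in> H \<Longrightarrow> L (\<lambda>x. f x - g x) = L f - L g"
  using L_add[OF _ scale_mem[of g "-1"], of f] L_scale[of g "-1"] by simp

lemma w_mem: "w \<in> KK_domain k" and \<nu>_upper: "\<nu> \<in> upper_half_plane"
  using point by (auto simp: mem_tensor_domain)

text \<open>
  The factorization of the kernel turns \<open>z\<^sub>j k\<^sub>u\<close> into a multiple of the difference of two kernel sections. That
  shows that \<open>z\<^sub>j k\<^sub>u\<close> is in \<open>H\<close>, and the eigenvalue relation for \<open>z\<^sub>j\<close> then gives for \<open>L\<close> the same factor that
  evaluation at \<open>(\<nu>, w)\<close> has.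
\<close>

lemma L_set_coordinate_zero:
  assumes \<mu>: "\<mu> \<in> upper_half_plane" and u: "u \<in> KK_domain k"
  shows "L (kernel_section (\<mu>, u(j := 0)))
    = (1 - w j * cnj (u j) * of_real (index_weight k j)) * L (kernel_section (\<mu>, u))"
proof (cases "u j = 0")
  case True
  then have "u(j := 0) = u" by auto
  then show ?thesis using True by simp
next
  case False
  define b where "b = cnj (u j) * of_real (index_weight k j)"
  have b: "b \<noteq> 0" using False index_weight_pos[of k j] by (simp add: b_def)
  let ?f = "kernel_section (\<mu>, u)" and ?g = "kernel_section (\<mu>, u(j := 0))"
  have u0: "u(j := 0) \<in> KK_domain k" by (rule KK_domain_mono[OF u]) simp
  have f: "?f \<in> H" and g: "?g \<in> H"
    using \<mu> u u0 by (auto intro!: kernel_section_mem simp: mem_tensor_domain)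
  have eq: "?g = (\<lambda>x. ?f x - b * (snd x j * ?f x))"
    using u by (auto simp: kernel_section_def mem_tensor_domain tensor_kernel_apply b_def
        K_kernel_set_coordinate_zero algebra_simps diff_divide_distrib)
  have "(\<lambda>x. snd x j * ?f x) = (\<lambda>x. inverse b * (?f x - ?g x))"
    using b by (subst eq) (simp add: mult.assoc[symmetric])
  then have "(\<lambda>x. snd x j * ?f x) \<in> H" using f g by (simp add: scale_mem diff_mem)
  then have "L ?g = L ?f - b * (w j * L ?f)"
    by (subst eq) (simp add: L_diff L_scale L_coordinate f scale_mem)
  then show ?thesis by (simp add: b_def algebra_simps)
qed

lemma L_drop_coordinates:
  assumes "\<mu> \<in> upper_half_plane" "u \<in> KK_domain k"
  shows "L (kernel_section (\<mu>, drop_coordinates n u)) * K_kernel k w u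
    = K_kernel k w (drop_coordinates n u) * L (kernel_section (\<mu>, u))"
proof (induction n)
  case (Suc n)
  have "drop_coordinates n u \<in> KK_domain k" by (rule KK_domain_drop_coordinates[OF assms(2)])
  then show ?case
    unfolding drop_coordinates_Suc
    by (simp only: L_set_coordinate_zero[OF assms(1)] K_kernel_set_coordinate_zero[OF w_mem]
        mult.assoc Suc.IH)
qed simp

lemma kernel_section_drop_coordinates_tendsto:
  assumes \<mu>: "\<mu> \<in> upper_half_plane" and u: "u \<in> KK_domain k"
  shows "(\<lambda>n. hnorm ip (\<lambda>x. kernel_section (\<mu>, drop_coordinates n u) x
      - kernel_section (\<mu>, \<lambda>_. 0) x)) \<longlonglongrightarrow> 0"
proof -
  define a where "a = 1 / (- \<i> * (\<mu> - cnj \<mu>))"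
  have mem: "(\<mu>, drop_coordinates n u) \<in> tensor_domain k" "(\<mu>, \<lambda>_. 0) \<in> tensor_domain k" for n
    using \<mu> KK_domain_drop_coordinates[OF u] zero_mem_KK_domain by (auto simp: mem_tensor_domain)
  have "(hnorm ip (\<lambda>x. kernel_section (\<mu>, drop_coordinates n u) x - kernel_section (\<mu>, \<lambda>_. 0) x))\<^sup>2
      = Re ((K_kernel k (drop_coordinates n u) (drop_coordinates n u) - 1) * a)" for n
    unfolding hnorm_diff_square[OF mem[THEN kernel_section_mem]]
      hnorm_square[OF mem(1)[THEN kernel_section_mem]] hnorm_square[OF mem(2)[THEN kernel_section_mem]]
      ip_kernel_section[OF mem(1)[THEN kernel_section_mem] mem(1)]
      ip_kernel_section[OF mem(1)[THEN kernel_section_mem] mem(2)]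
      ip_kernel_section[OF mem(2)[THEN kernel_section_mem] mem(2)]
    using mem by (simp add: kernel_section_def tensor_kernel_apply a_def
        K_kernel_zero_right K_kernel_zero_left algebra_simps diff_divide_distrib)
  moreover have "(\<lambda>n. Re ((K_kernel k (drop_coordinates n u) (drop_coordinates n u) - 1) * a))
      \<longlonglongrightarrow> Re ((1 - 1) * a)"
    by (intro tendsto_intros K_kernel_drop_coordinates_tendsto u)
  ultimately have "(\<lambda>n. sqrt ((hnorm ip (\<lambda>x. kernel_section (\<mu>, drop_coordinates n u) x
      - kernel_section (\<mu>, \<lambda>_. 0) x))\<^sup>2)) \<longlonglongrightarrow> sqrt (Re ((1 - 1) * a))"
    by (intro tendsto_real_sqrt) simp
  then show ?thesis
    using hnorm_nonneg[OF diff_mem[OF mem[THEN kernel_section_mem]]] by simp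
qed

text \<open>
  \<open>L\<close> and \<open>K\<^sub>k(w, \<cdot>)\<close> change by the same factors when coordinates of \<open>u\<close> are replaced by 0. After all
  coordinates are gone, the kernel is 1, and \<open>L\<close> has arrived at the kernel section at \<open>(\<mu>, 0)\<close>.
\<close>

lemma L_kernel_section_factor:
  assumes \<mu>: "\<mu> \<in> upper_half_plane" and u: "u \<in> KK_domain k"
  shows "L (kernel_section (\<mu>, u)) = K_kernel k w u * L (kernel_section (\<mu>, \<lambda>_. 0))"
proof -
  let ?k = "\<lambda>n. kernel_section (\<mu>, drop_coordinates n u)" and ?limit = "kernel_section (\<mu>, \<lambda>_. 0)"
  have mem: "?k n \<in> H" "?limit \<in> H" for n
    using \<mu> KK_domain_drop_coordinates[OF u] zero_mem_KK_domain
    by (auto simp: mem_tensor_domain intro!: kernel_section_mem)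
  have "(\<lambda>n. L (?k n) - L ?limit) \<longlonglongrightarrow> 0"
  proof (rule Lim_null_comparison)
    show "\<forall>\<^sub>F n in sequentially. norm (L (?k n) - L ?limit) \<le> C * hnorm ip (\<lambda>x. ?k n x - ?limit x)"
      using L_bound[OF diff_mem[OF mem]] by (simp add: L_diff mem)
    show "(\<lambda>n. C * hnorm ip (\<lambda>x. ?k n x - ?limit x)) \<longlonglongrightarrow> 0"
      using kernel_section_drop_coordinates_tendsto[OF assms] by (rule tendsto_mult_right_zero)
  qed
  then have "(\<lambda>n. L (?k n) * K_kernel k w u) \<longlonglongrightarrow> L ?limit * K_kernel k w u"
    by (intro tendsto_mult tendsto_const) (simp add: LIM_zero_iff)
  moreover have "(\<lambda>n. L (?k n) * K_kernel k w u) \<longlonglongrightarrow> 1 * L (kernel_section (\<mu>, u))"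
    unfolding L_drop_coordinates[OF assms]
    by (intro tendsto_mult tendsto_const K_kernel_drop_coordinates_tendsto w_mem u)
  ultimately show ?thesis using LIMSEQ_unique by fastforce
qed

text \<open>
  The ratio of \<open>L\<close> and evaluation at \<open>(\<nu>, w)\<close> on the kernel section at \<open>(\<i>, 0)\<close>, which has no zeros. Any
  other point of the half-plane could replace \<open>\<i>\<close>.
\<close>

definition multiplier :: complex where
  "multiplier = - \<i> * (\<nu> - cnj \<i>) * L (kernel_section (\<i>, \<lambda>_. 0))"

lemma L_kernel_section:
  assumes x: "x \<in> tensor_domain k"
  shows "L (kernel_section x) = multiplier * kernel_section x (\<nu>, w)"
proof -
  obtain \<mu> u where xu: "x = (\<mu>, u)" "\<mu> \<in> upper_half_plane" "u \<in> KK_domain k"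
    using x by (cases x) (simp add: mem_tensor_domain)
  interpret const: half_plane_rkhs "tensor_domain k" z_independent_functions ip
    by (rule z_independent_functions_half_plane_rkhs)
  have section_eq: "const.kernel_section (n, \<lambda>_. 0) = kernel_section (n, \<lambda>_. 0)" for n
    by (rule ext) (simp add: kernel_section_def const.kernel_section_def
        tensor_kernel_zero[of _ "(n, \<lambda>_. 0)", simplified])
  have mem: "(\<mu>, \<lambda>_. 0) \<in> tensor_domain k" "(\<i>, \<lambda>_. 0) \<in> tensor_domain k"
    using xu zero_mem_KK_domain by (auto simp: mem_tensor_domain upper_half_plane_def)
  have "(\<nu> - cnj (fst p)) * L (const.kernel_section p) = (\<nu> - cnj (fst q)) * L (const.kernel_section q)"
    if "p \<in> tensor_domain k" "q \<in> tensor_domain k" for p q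
    by (rule const.eigenfunctional_on_kernel_sections[where C = C])
       (use that C_nonneg in \<open>simp_all add: L_add L_scale L_bound L_chi
          subsetD[OF z_independent_functions_subset]\<close>)
  from this[OF mem]
  have "(\<nu> - cnj \<mu>) * L (kernel_section (\<mu>, \<lambda>_. 0)) = (\<nu> - cnj \<i>) * L (kernel_section (\<i>, \<lambda>_. 0))"
    by (simp only: section_eq fst_conv)
  then have "- \<i> * (\<nu> - cnj \<mu>) * L (kernel_section (\<mu>, \<lambda>_. 0)) = multiplier"
    by (simp only: multiplier_def mult.assoc)
  moreover have "- \<i> * (\<nu> - cnj \<mu>) \<noteq> 0"
    using \<nu>_upper xu(2) by (auto simp: upper_half_plane_def complex_eq_iff)
  ultimately have "L (kernel_section (\<mu>, \<lambda>_. 0)) = multiplier / (- \<i> * (\<nu> - cnj \<mu>))"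
    by (metis nonzero_eq_divide_eq mult.commute)
  then show ?thesis
    using L_kernel_section_factor[OF xu(2,3)] point
    by (simp add: xu(1) kernel_section_def tensor_kernel_apply)
qed

lemma L_eq_evaluation:
  assumes f: "f \<in> H"
  shows "L f = multiplier * f (\<nu>, w)"
proof -
  define D where "D = (\<lambda>f. L f - multiplier * f (\<nu>, w))"
  have bound: "cmod (D f) \<le> (C + cmod multiplier * hnorm ip (kernel_section (\<nu>, w))) * hnorm ip f"
    if "f \<in> H" for f
  proof -
    have "cmod (f (\<nu>, w)) \<le> hnorm ip f * hnorm ip (kernel_section (\<nu>, w))"
      using cauchy_schwarz[OF that kernel_section_mem[OF point]] ip_kernel_section[OF that point]
      by simp
    then have "cmod multiplier * cmod (f (\<nu>, w))
        \<le> cmod multiplier * (hnorm ip f * hnorm ip (kernel_section (\<nu>, w)))"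
      by (rule mult_left_mono) simp
    then show ?thesis
      using norm_triangle_ineq4[of "L f" "multiplier * f (\<nu>, w)"] L_bound[OF that]
      by (simp add: D_def norm_mult algebra_simps)
  qed
  have "D f = 0"
    by (rule functional_zero_of_kernel_sections[OF _ _ bound _ f])
       (simp_all add: D_def L_add L_scale L_kernel_section algebra_simps)
  then show ?thesis by (simp add: D_def)
qed

end

section \<open>Contractions commuting with the multiplications\<close>

theorem theorem8p1:
  fixes k :: nat
    and H :: "(complex \<times> (nat \<Rightarrow> complex) \<Rightarrow> complex) set"
    and ip :: "(complex \<times> (nat \<Rightarrow> complex) \<Rightarrow> complex) \<Rightarrow> (complex \<times> (nat \<Rightarrow> complex) \<Rightarrow> complex) \<Rightarrow> complex"
    and T :: "(complex \<times> (nat \<Rightarrow> complex) \<Rightarrow> complex) \<Rightarrow> (complex \<times> (nat \<Rightarrow> complex) \<Rightarrow> complex)"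
  assumes "k \<ge> 1"
    and "reproducing_kernel_hilbert_space (tensor_domain k) H ip (tensor_kernel k)"
    and "linear_contraction_on H ip T"
    and "\<And>f t. f \<in> H \<Longrightarrow> t \<ge> 0 \<Longrightarrow>
           T (\<lambda>(l, z). chi t l * f (l, z)) = (\<lambda>(l, z). chi t l * T f (l, z))"
    and "\<And>f j. f \<in> H \<Longrightarrow>
           T (\<lambda>(l, z). z j * f (l, z)) = (\<lambda>(l, z). z j * T f (l, z))"
  shows "\<exists>h :: complex \<Rightarrow> (nat \<Rightarrow> complex) \<Rightarrow> complex.
           (\<forall>f\<in>H. T f = (\<lambda>(l, z). h l z * f (l, z))) \<and>
           positive_kernel_on (tensor_domain k)
             (\<lambda>(l, z) (n, w). (1 - h l z * cnj (h n w)) * (K_kernel k z w / (- \<i> * (l - cnj n))))"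
proof -
  interpret hardy_tensor_space k H ip
    using assms(2) by (simp add: hardy_tensor_space_def)
  have T_mem: "T f \<in> H" if "f \<in> H" for f
    using assms(3) that by (simp add: linear_contraction_on_def)
  have T_norm: "hnorm ip (T f) \<le> hnorm ip f" if "f \<in> H" for f
    using assms(3) that by (simp add: linear_contraction_on_def)
  define h where "h = (\<lambda>l z. - \<i> * (l - cnj \<i>) * T (kernel_section (\<i>, \<lambda>_. 0)) (l, z))"
  have T_at: "T f x = h (fst x) (snd x) * f x" if f: "f \<in> H" and x: "x \<in> tensor_domain k" for f x
  proof -
    interpret coordinate_eigenfunctional k H ip "\<lambda>f. T f x" "hnorm ip (kernel_section x)" "fst x" "snd x"
    proof unfold_locales
      fix f assume f: "f \<in> H"
      show "T (\<lambda>x. c * f x) x = c * T f x" for c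
        using assms(3) f by (simp add: linear_contraction_on_def)
      have "cmod (T f x) \<le> hnorm ip (T f) * hnorm ip (kernel_section x)"
        using cauchy_schwarz[OF T_mem[OF f] kernel_section_mem[OF x]]
          ip_kernel_section[OF T_mem[OF f] x] by simp
      also have "\<dots> \<le> hnorm ip f * hnorm ip (kernel_section x)"
        by (rule mult_right_mono[OF T_norm[OF f] hnorm_nonneg[OF kernel_section_mem[OF x]]])
      finally show "cmod (T f x) \<le> hnorm ip (kernel_section x) * hnorm ip f"
        by (simp add: mult.commute)
      show "T (\<lambda>x. chi t (fst x) * f x) x = chi t (fst x) * T f x" if "0 \<le> t" for t
        using assms(4)[OF f that] by (simp add: case_prod_unfold)
      show "T (\<lambda>x. snd x j * f x) x = snd x j * T f x" for j
        using assms(5)[OF f, of j] by (simp add: case_prod_unfold)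
      show "T (\<lambda>x. f x + g x) x = T f x + T g x" if "g \<in> H" for g
        using assms(3) f that by (simp add: linear_contraction_on_def)
    qed (use x hnorm_nonneg[OF kernel_section_mem[OF x]] in simp_all)
    show ?thesis using L_eq_evaluation[OF f] by (simp add: multiplier_def h_def)
  qed
  have "T f = (\<lambda>(l, z). h l z * f (l, z))" if f: "f \<in> H" for f
  proof
    fix x
    show "T f x = (case x of (l, z) \<Rightarrow> h l z * f (l, z))"
      using T_at[OF f, of x] vanishes[OF f, of x] vanishes[OF T_mem[OF f], of x]
      by (cases "x \<in> tensor_domain k") (auto simp: case_prod_unfold)
  qed
  moreover have "positive_kernel_on (tensor_domain k)
      (\<lambda>(l, z) (n, w). (1 - h l z * cnj (h n w)) * (K_kernel k z w / (- \<i> * (l - cnj n))))"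
    using multiplier_kernel_positive[of T "\<lambda>x. h (fst x) (snd x)"] T_mem T_norm T_at
    by (simp add: tensor_kernel_def case_prod_unfold)
  ultimately show ?thesis by blast
qed

end
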